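(* Let $q>2$. If $\Gamma:S_L\to\mathbb{R}^n$ is an injective arclength parametrization of a closed curve with $\mathcal{E}_q(\Gamma)<\infty$, then $\Gamma$ is continuously differentiable with Hölder continuous tangent, namely $\Gamma$ is of class $C^{1,1-(2/q)}$. More precisely, for each $q>2$ there exist two constants $\delta(q)>0$ and $c(q)<\infty$ depending only on $q$ such that each injective arclength parametrization $\Gamma:S_L\to\mathbb{R}^n$ with $\mathcal{E}_q(\Gamma)<\infty$, with image $\gamma=\Gamma(S_L)$, satisfies $$|\Gamma'(u)-\Gamma'(v)|\le c(q)\left(\int_u^v\int_u^v\frac{ds\,dt}{r(\Gamma(s),\Gamma(t))^q}\right)^{1/q}|u-v|^{1-2/q}$$ for all $u,v\in S_L$ with $|u-v|\le\min\bigl(\delta(q)\,\mathcal{E}_q(\Gamma)^{-1/(q-2)},\ \tfrac12\operatorname{diam}\gamma\bigr)$.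
   Context: $S_L\cong\mathbb{R}/(L\mathbb{Z})$ is the circle of perimeter $L>0$; $|u-v|$ for $u,v\in S_L$ is the intrinsic distance on $S_L$, and $\int_u^v$ is integration over the shorter arc of $S_L$ between $u$ and $v$. An arclength parametrization of a closed curve of length $L$ is a Lipschitz map $\Gamma:S_L\to\mathbb{R}^n$ with $|\Gamma'|=1$ a.e. For $s\in S_L$ and almost every $t\in S_L$ (those where $\Gamma'(t)$ exists with $|\Gamma'(t)|=1$) let $\ell(t)=\{\Gamma(t)+\mu\Gamma'(t):\mu\in\mathbb{R}\}$ be the tangent line, and define the tangent-point radius $$r(\Gamma(t),\Gamma(s))=\frac{|\Gamma(t)-\Gamma(s)|^2}{2\operatorname{dist}(\ell(t),\Gamma(s))}\in[0,\infty],$$ where $r$ is set to be $0$ if $\Gamma(t)=\Gamma(s)$, and $r=\infty$ (i.e. $1/r=0$) if $\Gamma(s)-\Gamma(t)\neq0$ is parallel to $\Gamma'(t)$ (the tangent is always taken at the first argument). The tangent-point energy is $$\mathcal{E}_q(\Gamma)=\int_0^L\int_0^L\frac{ds\,dt}{r(\Gamma(t),\Gamma(s))^q}.$$ *)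

theory Defs
  imports "HOL-Analysis.Analysis"
begin

text \<open>
  The constants of the theorem depend on \<open>q\<close> only, not on the dimension \<open>n\<close>, so \<open>n\<close> has to be
  quantified inside the statement and cannot be a type.  All Euclidean spaces are therefore realised
  inside one inner product space, the finitely supported real sequences with the \<open>l\<^sup>2\<close> inner product;
  \<open>Rn n\<close> is the copy of n-dimensional Euclidean space formed by the sequences vanishing from index
  \<open>n\<close> on.  Norms, derivatives and diameters in this type agree with those of n-dimensional Euclidean
  space, since \<open>Rn n\<close> is a closed (finite-dimensional) subspace.
\<close>

typedef rinf = "{x :: nat \<Rightarrow> real. finite {i. x i \<noteq> 0}}"
  morphisms coord Abs_rinf
  by (rule exI[of _ "\<lambda>_. 0"]) simp

setup_lifting type_definition_rinf

lemma finite_support: "finite {i. coord x i \<noteq> 0}"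
  using coord[of x] by simp

lemma rinf_eqI: "(\<And>i. coord x i = coord y i) \<Longrightarrow> x = y"
  by (simp add: coord_inject[symmetric] fun_eq_iff)

instantiation rinf :: real_vector
begin

lift_definition zero_rinf :: rinf is "\<lambda>_. 0" by simp

lift_definition plus_rinf :: "rinf \<Rightarrow> rinf \<Rightarrow> rinf" is "\<lambda>x y i. x i + y i"
proof -
  fix x y :: "nat \<Rightarrow> real"
  assume "finite {i. x i \<noteq> 0}" "finite {i. y i \<noteq> 0}"
  then show "finite {i. x i + y i \<noteq> 0}"
    by (rule_tac finite_subset[of _ "{i. x i \<noteq> 0} \<union> {i. y i \<noteq> 0}"]) auto
qed

lift_definition minus_rinf :: "rinf \<Rightarrow> rinf \<Rightarrow> rinf" is "\<lambda>x y i. x i - y i"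
proof -
  fix x y :: "nat \<Rightarrow> real"
  assume "finite {i. x i \<noteq> 0}" "finite {i. y i \<noteq> 0}"
  then show "finite {i. x i - y i \<noteq> 0}"
    by (rule_tac finite_subset[of _ "{i. x i \<noteq> 0} \<union> {i. y i \<noteq> 0}"]) auto
qed

lift_definition uminus_rinf :: "rinf \<Rightarrow> rinf" is "\<lambda>x i. - x i" by simp

lift_definition scaleR_rinf :: "real \<Rightarrow> rinf \<Rightarrow> rinf" is "\<lambda>r x i. r * x i"
  by (erule rev_finite_subset) auto

instance
  by standard (transfer; simp add: fun_eq_iff algebra_simps)+

end

lemma coord_simps [simp]:
  "coord 0 i = 0" "coord (x + y) i = coord x i + coord y i"
  "coord (x - y) i = coord x i - coord y i" "coord (- x) i = - coord x i"
  "coord (r *\<^sub>R x) i = r * coord x i"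
  by (transfer; simp)+

instantiation rinf :: real_inner
begin

definition inner_rinf :: "rinf \<Rightarrow> rinf \<Rightarrow> real"
  where "inner_rinf x y = (\<Sum>i | coord x i \<noteq> 0. coord x i * coord y i)"

definition norm_rinf :: "rinf \<Rightarrow> real"
  where "norm_rinf x = sqrt (inner x x)"

definition sgn_rinf :: "rinf \<Rightarrow> rinf"
  where "sgn_rinf x = x /\<^sub>R norm x"

definition dist_rinf :: "rinf \<Rightarrow> rinf \<Rightarrow> real"
  where "dist_rinf x y = norm (x - y)"

definition uniformity_rinf :: "(rinf \<times> rinf) filter"
  where "uniformity_rinf = (INF e\<in>{0<..}. principal {(x, y). dist x y < e})"

definition open_rinf :: "rinf set \<Rightarrow> bool"
  where "open_rinf U \<longleftrightarrow> (\<forall>x\<in>U. eventually (\<lambda>(x', y). x' = x \<longrightarrow> y \<in> U) uniformity)"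

lemma inner_rinf_superset:
  assumes "finite A" "{i. coord x i \<noteq> 0} \<subseteq> A"
  shows "inner x y = (\<Sum>i\<in>A. coord x i * coord y i)"
  unfolding inner_rinf_def using assms by (intro sum.mono_neutral_left) auto

instance
proof
  fix x y z :: rinf and r :: real and U :: "rinf set"
  let ?A = "{i. coord x i \<noteq> 0} \<union> {i. coord y i \<noteq> 0} \<union> {i. coord z i \<noteq> 0}"
  have fin: "finite ?A" by (simp add: finite_support)
  note sup = inner_rinf_superset[OF fin]
  have *: "inner x w = (\<Sum>i\<in>?A. coord x i * coord w i)"
    "inner y w = (\<Sum>i\<in>?A. coord y i * coord w i)"
    "inner (x + y) w = (\<Sum>i\<in>?A. (coord x i + coord y i) * coord w i)"
    "inner (r *\<^sub>R x) w = (\<Sum>i\<in>?A. r * coord x i * coord w i)" for w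
    by (subst sup; auto)+
  show "inner x y = inner y x"
    by (simp only: * mult.commute)
  show "inner (x + y) z = inner x z + inner y z"
    by (simp only: * distrib_right sum.distrib)
  show "inner (r *\<^sub>R x) y = r * inner x y"
    by (simp only: * sum_distrib_left mult.assoc)
  show "0 \<le> inner x x"
    by (auto simp: inner_rinf_def intro: sum_nonneg)
  show "inner x x = 0 \<longleftrightarrow> x = 0"
  proof
    assume "inner x x = 0"
    then have "\<forall>i\<in>{i. coord x i \<noteq> 0}. coord x i * coord x i = 0"
      unfolding inner_rinf_def
      by (subst (asm) sum_nonneg_eq_0_iff) (auto simp: finite_support)
    then show "x = 0" by (intro rinf_eqI) auto
  qed (simp add: inner_rinf_def)
qed (rule norm_rinf_def sgn_rinf_def dist_rinf_def uniformity_rinf_def open_rinf_def)+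

end

definition Rn :: "nat \<Rightarrow> rinf set"
  where "Rn n = {x. \<forall>i\<ge>n. coord x i = 0}"

lemma inner_Rn: "x \<in> Rn n \<Longrightarrow> inner x y = (\<Sum>i<n. coord x i * coord y i)"
  by (rule inner_rinf_superset) (auto simp: Rn_def not_le[symmetric])

lemma norm_Rn: "x \<in> Rn n \<Longrightarrow> norm x = L2_set (coord x) {..<n}"
  by (simp add: norm_eq_sqrt_inner inner_Rn L2_set_def power2_eq_square)

lemma subspace_Rn: "subspace (Rn n)"
  by (auto simp: Rn_def subspace_def)


text \<open>
  Points of the circle \<open>\<real>/L\<int>\<close> are given by real representatives, and maps on it by \<open>L\<close>-periodic
  functions on the reals.
\<close>

definition circle_dist :: "real \<Rightarrow> real \<Rightarrow> real \<Rightarrow> real"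
  where "circle_dist L u v = (INF k::int. \<bar>u - v + of_int k * L\<bar>)"

text \<open>
  The shorter arc is lifted to the line: it runs from \<open>u\<close> to the representative of \<open>v\<close> nearest to
  \<open>u\<close>.  (For antipodal points, where the shorter arc is ambiguous, this picks one of the two.)
  Integrating a periodic function over the lift is integrating over the arc.
\<close>

definition shorter_arc :: "real \<Rightarrow> real \<Rightarrow> real \<Rightarrow> real set"
  where "shorter_arc L u v = closed_segment u (v + of_int (round ((u - v) / L)) * L)"

definition arclength_parametrization :: "nat \<Rightarrow> real \<Rightarrow> (real \<Rightarrow> rinf) \<Rightarrow> bool"
  where "arclength_parametrization n L \<Gamma> \<longleftrightarrow>
    L > 0 \<and> range \<Gamma> \<subseteq> Rn n \<and> (\<forall>t. \<Gamma> (t + L) = \<Gamma> t) \<and>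
    (\<exists>C. \<forall>u v. dist (\<Gamma> u) (\<Gamma> v) \<le> C * circle_dist L u v) \<and>
    (AE t in lborel. \<Gamma> differentiable at t \<and> norm (vector_derivative \<Gamma> (at t)) = 1)"

definition injective_arclength_parametrization :: "nat \<Rightarrow> real \<Rightarrow> (real \<Rightarrow> rinf) \<Rightarrow> bool"
  where "injective_arclength_parametrization n L \<Gamma> \<longleftrightarrow>
    arclength_parametrization n L \<Gamma> \<and> inj_on \<Gamma> {0..<L}"

definition tangent_line :: "(real \<Rightarrow> 'a::real_normed_vector) \<Rightarrow> real \<Rightarrow> 'a set"
  where "tangent_line \<Gamma> t = range (\<lambda>\<mu>. \<Gamma> t + \<mu> *\<^sub>R vector_derivative \<Gamma> (at t))"

text \<open>
  Meaningful for those \<open>t\<close> at which \<open>\<Gamma>\<close> has a unit derivative; the other \<open>t\<close> form a null set and do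
  not affect the integrals below.
\<close>

definition tangent_point_radius :: "(real \<Rightarrow> 'a::real_normed_vector) \<Rightarrow> real \<Rightarrow> real \<Rightarrow> ennreal"
  where "tangent_point_radius \<Gamma> t s =
    (if \<Gamma> t = \<Gamma> s then 0
     else if \<Gamma> s \<in> tangent_line \<Gamma> t then top
     else ennreal ((norm (\<Gamma> t - \<Gamma> s))\<^sup>2 / (2 * infdist (\<Gamma> s) (tangent_line \<Gamma> t))))"

text \<open>Only used with exponents \<open>a > 0\<close>; negative powers are written with \<open>inverse\<close>, for which
  \<open>inverse 0 = top\<close> and \<open>inverse top = 0\<close>.\<close>

definition ennreal_powr :: "ennreal \<Rightarrow> real \<Rightarrow> ennreal"
  where "ennreal_powr x a = (if x = top then top else ennreal (enn2real x powr a))"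

definition tangent_point_energy :: "real \<Rightarrow> real \<Rightarrow> (real \<Rightarrow> 'a::real_normed_vector) \<Rightarrow> ennreal"
  where "tangent_point_energy q L \<Gamma> =
    (\<integral>\<^sup>+t\<in>{0..L}. (\<integral>\<^sup>+s\<in>{0..L}.
       inverse (ennreal_powr (tangent_point_radius \<Gamma> t s) q) \<partial>lborel) \<partial>lborel)"

definition C1_holder_on_circle :: "real \<Rightarrow> real \<Rightarrow> (real \<Rightarrow> 'a::real_normed_vector) \<Rightarrow> bool"
  where "C1_holder_on_circle L \<alpha> \<Gamma> \<longleftrightarrow>
    \<Gamma> C1_differentiable_on UNIV \<and>
    (\<exists>C. \<forall>u v. norm (vector_derivative \<Gamma> (at u) - vector_derivative \<Gamma> (at v))
             \<le> C * circle_dist L u v powr \<alpha>)"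

end

theory Submission
  imports Defs
begin

text \<open>
  The proof has two stages: a multi-scale argument that makes \<open>\<Gamma>\<close> continuously differentiable, with a
  tangent that oscillates little below a scale controlled by the energy \<open>E\<close>, and a Morrey-type chaining
  argument that turns this into the sharp Hoelder estimate with the energy of the arc alone.

  First stage.  Since \<open>\<Gamma>\<close> is 1-Lipschitz, Chebyshev's inequality provides near every point
  \<open>x = \<Gamma> s\<^sub>0\<close> a parameter \<open>t\<close> with \<open>1/r(\<Gamma> t, \<Gamma> s)\<close> bounded for a set of \<open>s\<close> that comes close to every
  parameter; all points of the curve within distance \<open>h\<close> of \<open>x\<close>, however far away along the curve,
  then lie in a tube around the tangent line at \<open>t\<close> of width a constant times \<open>h \<cdot> flatness h\<close>, where
  \<open>flatness h = (E h\<^bsup>q-2\<^esup>)\<^bsup>1/(q+2)\<^esup>\<close> (\<open>tube\<close>).  As \<open>q > 2\<close>, these relative widths sum up over dyadic scales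
  to a multiple of the largest one.  Following the tubes around one point \<open>y\<close> from a large scale down to
  a small one shows that all chords of length at most \<open>h\<close> issuing from \<open>y\<close> are parallel up to sign
  and a small error (\<open>thin_triangle\<close>).  Hence on a short arc with end points \<open>\<Gamma> a\<close>, \<open>\<Gamma> b\<close> every chord is almost parallel
  to \<open>\<Gamma> b - \<Gamma> a\<close>.  No chord is perpendicular to that direction, so the projection of the arc to it is
  injective, therefore monotone (\<open>chords_oriented\<close>); this is how injectivity of \<open>\<Gamma>\<close> rules out hairpins that
  run back along themselves.  The difference quotients then form a Cauchy family, which gives the
  continuous unit tangent (\<open>differentiable_everywhere\<close>, \<open>continuous_derivative\<close>, \<open>norm_derivative\<close>).

  Second stage.  At small scales the chord from \<open>\<Gamma> t\<close> to \<open>\<Gamma> s\<close> points in nearly the same direction as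
  both tangents, so that \<open>\<bar>\<Gamma>'(t) - \<Gamma>'(s)\<bar>\<close> is at most a multiple of \<open>\<bar>t - s\<bar>\<close> times a
  common bound for the inverse radii
  \<open>1/r(\<Gamma> t, \<Gamma> s)\<close> and \<open>1/r(\<Gamma> s, \<Gamma> t)\<close> (\<open>derivative_increment_le\<close>).  The energy of an arc
  thus controls a fractional Sobolev seminorm of \<open>\<Gamma>'\<close> on this arc, and the one-dimensional embedding
  theorem of Garsia, Rodemich and Rumsey gives the Hoelder exponent \<open>1 - 2/q\<close>.  Its proof is included in
  \<open>derivative_holder_positive\<close>: a chain of parameters at distances \<open>d/2\<^sup>m\<close> from a given one is chosen such that
  consecutive members have large radii.
\<close>

section \<open>A mean value inequality for Lipschitz functions\<close>

text \<open>
  The function \<open>h x = g x - (m - e) x\<close> has positive derivative off a null set \<open>N\<close>, and \<open>h\<close> maps \<open>N\<close> to a null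
  set because it is Lipschitz.  If \<open>h b < h a\<close>, some value \<open>c\<close> between the two is therefore not taken on \<open>N\<close>;
  at the last point where \<open>h = c\<close> the derivative is positive, so \<open>h\<close> exceeds \<open>c\<close> just after it and has to
  take the value \<open>c\<close> once more.
\<close>
lemma lipschitz_increment_ge:
  fixes g :: "real \<Rightarrow> real"
  assumes lip: "\<And>x y. \<bar>g x - g y\<bar> \<le> C * \<bar>x - y\<bar>"
    and der: "AE x in lborel. x \<in> {a<..<b} \<longrightarrow> (\<exists>D. (g has_real_derivative D) (at x) \<and> m \<le> D)"
    and "a \<le> b"
  shows "m * (b - a) \<le> g b - g a"
proof (rule ccontr)
  assume "\<not> ?thesis"
  then have less: "g b - m * b < g a - m * a" by (simp add: algebra_simps)
  then have "a < b" using \<open>a \<le> b\<close> by (cases "a = b") auto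
  define e where "e = ((g a - m * a) - (g b - m * b)) / (2 * (b - a))"
  have "e > 0" using less \<open>a < b\<close> by (simp add: e_def)
  have "e * (2 * (b - a)) = (g a - m * a) - (g b - m * b)"
    unfolding e_def by (subst times_divide_eq_left, subst nonzero_mult_div_cancel_right) (use \<open>a < b\<close> in auto)
  then have e2: "e * (b - a) < (g a - m * a) - (g b - m * b)"
    using less by (simp only: mult.left_commute[of e 2])
  define h where "h x = g x - (m - e) * x" for x
  have hab: "h b < h a" using e2 by (simp add: h_def algebra_simps)
  define K where "K = C + \<bar>m - e\<bar>"
  have hlip: "\<bar>h x - h y\<bar> \<le> K * \<bar>x - y\<bar>" for x y
  proof -
    have "h x - h y = (g x - g y) - (m - e) * (x - y)" by (simp add: h_def algebra_simps)
    then have "\<bar>h x - h y\<bar> \<le> \<bar>g x - g y\<bar> + \<bar>m - e\<bar> * \<bar>x - y\<bar>"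
      by (simp add: abs_mult[symmetric])
    then show ?thesis using lip[of x y] by (simp add: K_def algebra_simps)
  qed
  define N where "N = {x \<in> {a<..<b}. \<not> (\<exists>D. (g has_real_derivative D) (at x) \<and> m \<le> D)}"
  have "AE x in lebesgue. x \<notin> N"
    using AE_completion[OF der] by eventually_elim (auto simp: N_def)
  then have "N \<in> null_sets lebesgue" by (subst completion.null_sets_iff_AE) auto
  then have "negligible (insert a N)" by (simp add: negligible_iff_null_sets)
  then have "negligible (h ` insert a N)"
  proof (rule negligible_locally_Lipschitz_image[rotated])
    fix x assume "x \<in> insert a N"
    show "\<exists>T B. open T \<and> x \<in> T \<and> (\<forall>y\<in>insert a N \<inter> T. norm (h y - h x) \<le> B * norm (y - x))"
      using hlip by (intro exI[of _ UNIV] exI[of _ K]) auto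
  qed simp
  moreover have "\<not> negligible {h b<..<h a}" 
    using hab open_not_negligible[of "{h b<..<h a}"] by simp
  ultimately obtain c where c: "c \<in> {h b<..<h a}" "c \<notin> h ` insert a N"
    using negligible_subset[of "h ` insert a N" "{h b<..<h a}"] by blast
  have cont: "continuous_on UNIV h"
  proof (rule lipschitz_on_continuous_on[of "\<bar>K\<bar>"], rule lipschitz_onI)
    fix x y
    have "K * \<bar>x - y\<bar> \<le> \<bar>K\<bar> * \<bar>x - y\<bar>" by (intro mult_right_mono) auto
    then show "dist (h x) (h y) \<le> \<bar>K\<bar> * dist x y" using hlip[of x y] by (simp add: dist_real_def)
  qed simp
  \<comment> \<open>the last point of the interval at which \<open>h\<close> takes the value \<open>c\<close>\<close>
  define S where "S = {x \<in> {a..b}. h x = c}"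
  have "\<exists>x. a \<le> x \<and> x \<le> b \<and> h x = c"
    using c \<open>a \<le> b\<close> cont by (intro IVT2') (auto intro: continuous_on_subset)
  then have "S \<noteq> {}" by (auto simp: S_def)
  have "compact S"
  proof -
    have "S = {a..b} \<inter> h -` {c}" by (auto simp: S_def)
    moreover have "closed (h -` {c})" using cont by (intro continuous_closed_vimage) (auto simp: continuous_on_eq_continuous_at)
    ultimately show ?thesis by (simp add: compact_Int_closed)
  qed
  then obtain x where x: "x \<in> S" and max: "\<And>y. y \<in> S \<Longrightarrow> y \<le> x"
    using compact_attains_sup[OF _ \<open>S \<noteq> {}\<close>] by blast
  have "x \<noteq> b" "x \<noteq> a" using x c by (auto simp: S_def)
  then have xab: "a < x" "x < b" "h x = c" using x by (auto simp: S_def)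
  then have "x \<notin> N" using c by auto
  then obtain D where D: "(g has_real_derivative D) (at x)" "m \<le> D"
    using xab by (auto simp: N_def)
  have "(h has_real_derivative (D - (m - e))) (at x)"
    unfolding h_def by (auto intro!: derivative_eq_intros D(1))
  moreover have "D - (m - e) > 0" using D \<open>e > 0\<close> by simp
  ultimately obtain d where d: "d > 0" "\<And>k. 0 < k \<Longrightarrow> k < d \<Longrightarrow> h x < h (x + k)"
    using DERIV_pos_inc_right by blast
  define y where "y = x + min (d / 2) (b - x)"
  have y: "x < y" "y \<le> b" "h y > c"
    using d(2)[of "min (d / 2) (b - x)"] d(1) xab by (auto simp: y_def min_def)
  have "\<exists>z. y \<le> z \<and> z \<le> b \<and> h z = c"
    using c y cont by (intro IVT2') (auto intro: continuous_on_subset)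
  then obtain z where "y \<le> z" "z \<le> b" "h z = c" by blast
  then have "z \<in> S" using y xab by (auto simp: S_def)
  then show False using max[of z] y \<open>y \<le> z\<close> by linarith
qed

section \<open>Normal parts and directions up to sign\<close>

definition normal_part :: "'a::real_inner \<Rightarrow> 'a \<Rightarrow> 'a"
  where "normal_part T c = c - (c \<bullet> T) *\<^sub>R T"

lemma normal_part_diff: "normal_part T (c - d) = normal_part T c - normal_part T d"
  by (simp add: normal_part_def algebra_simps)

lemma normal_part_add: "normal_part T (c + d) = normal_part T c + normal_part T d"
  by (simp add: normal_part_def algebra_simps)

lemma normal_part_scaleR: "normal_part T (r *\<^sub>R c) = r *\<^sub>R normal_part T c"
  by (simp add: normal_part_def algebra_simps)

text \<open>
  Pythagoras, for the distance of \<open>c\<close> to the points of the line spanned by \<open>T\<close>.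
\<close>
lemma norm_line_distance:
  assumes "norm T = 1"
  shows "(norm (c - \<mu> *\<^sub>R T))\<^sup>2 = (norm (normal_part T c))\<^sup>2 + (c \<bullet> T - \<mu>)\<^sup>2"
proof -
  have "T \<bullet> T = 1" using assms by (simp add: norm_eq_1)
  then show ?thesis
    unfolding normal_part_def power2_norm_eq_inner
    by (simp add: inner_diff_left inner_diff_right inner_commute power2_eq_square algebra_simps)
qed

lemma norm_normal_part_le_line:
  assumes "norm T = 1"
  shows "norm (normal_part T c) \<le> norm (c - \<mu> *\<^sub>R T)"
  by (rule power2_le_imp_le) (use norm_line_distance[OF assms, of c \<mu>] in auto)

lemma norm_normal_part_le: "norm T = 1 \<Longrightarrow> norm (normal_part T c) \<le> norm c"
  using norm_normal_part_le_line[of T c 0] by simp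

lemma infdist_line:
  assumes "norm T = 1"
  shows "infdist y (range (\<lambda>\<mu>. p + \<mu> *\<^sub>R T)) = norm (normal_part T (y - p))"
proof (rule antisym)
  show "infdist y (range (\<lambda>\<mu>. p + \<mu> *\<^sub>R T)) \<le> norm (normal_part T (y - p))"
    by (rule infdist_le2[of "p + ((y - p) \<bullet> T) *\<^sub>R T"])
      (auto simp: dist_norm normal_part_def diff_diff_eq)
  show "norm (normal_part T (y - p)) \<le> infdist y (range (\<lambda>\<mu>. p + \<mu> *\<^sub>R T))"
  proof -
    have "norm (normal_part T (y - p)) \<le> dist y (p + \<mu> *\<^sub>R T)" for \<mu>
      using norm_normal_part_le_line[OF assms, of "y - p" \<mu>] by (simp add: dist_norm algebra_simps)
    then show ?thesis by (subst infdist_notempty) (auto intro!: cINF_greatest)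
  qed
qed

text \<open>
  Directions are compared without orientation at first: tubes around lines cannot tell a curve from
  one that runs back and forth.
\<close>
definition almost_parallel :: "real \<Rightarrow> 'a::real_normed_vector \<Rightarrow> 'a \<Rightarrow> bool"
  where "almost_parallel \<epsilon> v w \<longleftrightarrow> norm (v - w) \<le> \<epsilon> \<or> norm (v + w) \<le> \<epsilon>"

lemma almost_parallel_sym: "almost_parallel \<epsilon> v w \<Longrightarrow> almost_parallel \<epsilon> w v"
  by (metis add.commute almost_parallel_def norm_minus_commute)

lemma almost_parallel_mono: "almost_parallel \<epsilon> v w \<Longrightarrow> \<epsilon> \<le> \<epsilon>' \<Longrightarrow> almost_parallel \<epsilon>' v w"
  by (auto simp: almost_parallel_def)

lemma almost_parallel_uminus [simp]:
  "almost_parallel \<epsilon> (- v) w = almost_parallel \<epsilon> v w"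
  "almost_parallel \<epsilon> v (- w) = almost_parallel \<epsilon> v w"
  by (auto simp: almost_parallel_def norm_minus_commute add.commute)

lemma almost_parallel_trans:
  assumes "almost_parallel \<epsilon> u v" "almost_parallel \<epsilon>' v w"
  shows "almost_parallel (\<epsilon> + \<epsilon>') u w"
proof -
  have *: "almost_parallel (\<epsilon> + \<epsilon>') u w"
    if "norm (u - v') \<le> \<epsilon>" "norm (v' - w) \<le> \<epsilon>' \<or> norm (v' + w) \<le> \<epsilon>'" for v'
    using that norm_triangle_le[of "u - v'" "v' - w" "\<epsilon> + \<epsilon>'"] norm_triangle_le[of "u - v'" "v' + w" "\<epsilon> + \<epsilon>'"]
    by (auto simp: almost_parallel_def)
  have "norm (- v - w) = norm (v + w)" "norm (- v + w) = norm (v - w)"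
    by (metis minus_add_distrib norm_minus_cancel diff_conv_add_uminus) (simp add: norm_minus_commute)
  then show ?thesis
    using assms *[of v] *[of "- v"] by (auto simp: almost_parallel_def)
qed

text \<open>
  With \<open>\<alpha> = sgn c \<bullet> T\<close>, both the normal part of \<open>sgn c\<close> and the defect \<open>1 - \<bar>\<alpha>\<bar>\<close> of its tangential part are at
  most \<open>\<eta>\<close>.
\<close>
lemma almost_parallel_sgn_axis:
  assumes T: "norm T = 1" and "c \<noteq> 0" and le: "norm (normal_part T c) \<le> \<eta> * norm c"
  shows "almost_parallel (2 * \<eta>) (sgn c) T"
proof -
  define \<alpha> where "\<alpha> = sgn c \<bullet> T"
  have n1: "norm (sgn c) = 1" using \<open>c \<noteq> 0\<close> by (simp add: norm_sgn)
  have "normal_part T (sgn c) = (1 / norm c) *\<^sub>R normal_part T c"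
    by (simp add: sgn_div_norm normal_part_scaleR divide_inverse)
  then have n: "norm (normal_part T (sgn c)) \<le> \<eta>"
    using le \<open>c \<noteq> 0\<close> by (simp add: field_simps)
  have dec: "sgn c - \<alpha> *\<^sub>R T = normal_part T (sgn c)" by (simp add: normal_part_def \<alpha>_def)
  have a1: "\<bar>\<alpha>\<bar> \<le> 1" using Cauchy_Schwarz_ineq2[of "sgn c" T] n1 T by (simp add: \<alpha>_def)
  have a2: "1 - \<bar>\<alpha>\<bar> \<le> \<eta>"
    using norm_triangle_ineq2[of "sgn c" "\<alpha> *\<^sub>R T"] n1 T n dec by simp
  have "norm (sgn c - \<sigma> *\<^sub>R T) \<le> 2 * \<eta>" if "\<bar>\<alpha> - \<sigma>\<bar> = 1 - \<bar>\<alpha>\<bar>" for \<sigma>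
  proof -
    have "norm (sgn c - \<sigma> *\<^sub>R T) = norm (normal_part T (sgn c) + (\<alpha> - \<sigma>) *\<^sub>R T)"
      using dec by (simp add: algebra_simps flip: dec)
    also have "\<dots> \<le> norm (normal_part T (sgn c)) + \<bar>\<alpha> - \<sigma>\<bar>"
      using norm_triangle_ineq[of "normal_part T (sgn c)" "(\<alpha> - \<sigma>) *\<^sub>R T"] T by simp
    finally show ?thesis using n a2 that by simp
  qed
  from this[of 1] this[of "-1"] show ?thesis
    using a1 by (cases "\<alpha> \<ge> 0") (auto simp: almost_parallel_def)
qed

lemma norm_diff_unit:
  assumes "norm v = 1" "norm w = 1"
  shows "(norm (v - w))\<^sup>2 = 2 - 2 * (v \<bullet> w)"
  using assms by (simp add: power2_norm_eq_inner algebra_simps inner_commute norm_eq_1)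

section \<open>The energy density\<close>

text \<open>
  The integrand \<open>1/r\<^sup>q\<close> of the energy, with the tangent taken at the parameter \<open>t\<close>.
\<close>
definition tp_kernel :: "real \<Rightarrow> (real \<Rightarrow> 'a::real_normed_vector) \<Rightarrow> real \<Rightarrow> real \<Rightarrow> ennreal"
  where "tp_kernel q \<Gamma> t s = inverse (ennreal_powr (tangent_point_radius \<Gamma> t s) q)"

lemma tp_kernel_eq:
  fixes \<Gamma> :: "real \<Rightarrow> 'a::real_inner"
  assumes T: "norm (vector_derivative \<Gamma> (at t)) = 1" and "q > 0"
  shows "tp_kernel q \<Gamma> t s = (if \<Gamma> t = \<Gamma> s then top else
    ennreal ((2 * norm (normal_part (vector_derivative \<Gamma> (at t)) (\<Gamma> s - \<Gamma> t)) / (norm (\<Gamma> s - \<Gamma> t))\<^sup>2) powr q))"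
proof -
  define T where "T = vector_derivative \<Gamma> (at t)"
  have T1: "norm T = 1" using T by (simp add: T_def)
  define D where "D = norm (normal_part T (\<Gamma> s - \<Gamma> t))"
  have inf: "infdist (\<Gamma> s) (tangent_line \<Gamma> t) = D"
    unfolding tangent_line_def D_def T_def by (rule infdist_line) (use T in simp)
  have mem: "\<Gamma> s \<in> tangent_line \<Gamma> t \<longleftrightarrow> D = 0"
  proof
    assume "\<Gamma> s \<in> tangent_line \<Gamma> t"
    then show "D = 0" using inf by (metis infdist_zero)
  next
    assume "D = 0"
    then have "\<Gamma> s = \<Gamma> t + ((\<Gamma> s - \<Gamma> t) \<bullet> T) *\<^sub>R T" by (simp add: D_def normal_part_def algebra_simps)
    then show "\<Gamma> s \<in> tangent_line \<Gamma> t" unfolding tangent_line_def T_def by blast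
  qed
  show ?thesis
  proof (cases "\<Gamma> t = \<Gamma> s")
    case True
    then show ?thesis using \<open>q > 0\<close> by (simp add: tp_kernel_def tangent_point_radius_def ennreal_powr_def)
  next
    case False
    define n where "n = norm (\<Gamma> s - \<Gamma> t)"
    have n: "n > 0" "norm (\<Gamma> t - \<Gamma> s) = n" using False by (auto simp: n_def norm_minus_commute)
    show ?thesis
    proof (cases "D = 0")
      case True
      then show ?thesis using False mem
        by (simp add: tp_kernel_def tangent_point_radius_def ennreal_powr_def D_def T_def)
    next
      case D: False
      then have D0: "D > 0" by (simp add: D_def)
      have "tp_kernel q \<Gamma> t s = inverse (ennreal ((n\<^sup>2 / (2 * D)) powr q))"
        using False D mem D0 n by (simp add: tp_kernel_def tangent_point_radius_def ennreal_powr_def inf)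
      also have "\<dots> = ennreal (inverse ((n\<^sup>2 / (2 * D)) powr q))"
        using D0 n by (subst inverse_ennreal) auto
      also have "inverse ((n\<^sup>2 / (2 * D)) powr q) = (2 * D / n\<^sup>2) powr q"
        using D0 n by (simp add: powr_divide)
      finally show ?thesis using False by (simp add: D_def T_def n_def)
    qed
  qed
qed

lemma normal_part_le_of_tp_kernel:
  fixes \<Gamma> :: "real \<Rightarrow> 'a::real_inner"
  assumes T: "norm (vector_derivative \<Gamma> (at t)) = 1" and "q > 0" and "M \<ge> 0"
    and le: "tp_kernel q \<Gamma> t s \<le> ennreal M"
  shows "norm (normal_part (vector_derivative \<Gamma> (at t)) (\<Gamma> s - \<Gamma> t)) \<le> (norm (\<Gamma> s - \<Gamma> t))\<^sup>2 * M powr (1 / q) / 2"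
proof (cases "\<Gamma> t = \<Gamma> s")
  case True
  then show ?thesis by (simp add: normal_part_def)
next
  case False
  define D where "D = norm (normal_part (vector_derivative \<Gamma> (at t)) (\<Gamma> s - \<Gamma> t))"
  define n where "n = norm (\<Gamma> s - \<Gamma> t)"
  have n: "n > 0" using False by (auto simp: n_def)
  have D0: "D \<ge> 0" by (simp add: D_def)
  have "(2 * D / n\<^sup>2) powr q \<le> M"
    using le False \<open>M \<ge> 0\<close> by (simp add: tp_kernel_eq[OF T \<open>q > 0\<close>] D_def n_def)
  then have "((2 * D / n\<^sup>2) powr q) powr (1 / q) \<le> M powr (1 / q)"
    using \<open>q > 0\<close> by (intro powr_mono2) auto
  then have "2 * D / n\<^sup>2 \<le> M powr (1 / q)"
    using \<open>q > 0\<close> D0 n by (simp add: powr_powr)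
  then show ?thesis using n by (simp add: field_simps D_def n_def)
qed

text \<open>
  Chebyshev's inequality, in a form that applies before the tangent is known to depend measurably on
  the parameter.
\<close>
lemma exists_le_of_nn_integral:
  fixes f :: "real \<Rightarrow> ennreal"
  assumes "0 < a" "0 < m" and sub: "{p..p + a} \<subseteq> X"
    and int: "(\<integral>\<^sup>+t\<in>X. f t \<partial>lborel) \<le> ennreal m"
    and P: "AE t in lborel. P t"
  shows "\<exists>t\<in>{p..p + a}. P t \<and> f t \<le> ennreal (2 * m / a)"
proof (rule ccontr)
  assume "\<not> ?thesis"
  then have *: "\<And>t. t \<in> {p..p + a} \<Longrightarrow> P t \<Longrightarrow> ennreal (2 * m / a) < f t" by (auto simp: not_le)
  have "ennreal (2 * m) = (\<integral>\<^sup>+t. ennreal (2 * m / a) * indicator {p..p + a} t \<partial>lborel)"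
    using \<open>0 < a\<close> \<open>0 < m\<close> by (subst nn_integral_cmult_indicator) (auto simp flip: ennreal_mult)
  also have "\<dots> \<le> (\<integral>\<^sup>+t\<in>X. f t \<partial>lborel)"
    by (rule nn_integral_mono_AE, use P in eventually_elim)
      (use * sub in \<open>auto simp: indicator_def less_imp_le\<close>)
  also have "\<dots> \<le> ennreal m" by (rule int)
  finally show False using \<open>0 < m\<close> by simp
qed

section \<open>Geometric sums over dyadic scales\<close>

text \<open>
  The value of the geometric series \<open>\<Sum>k. a \<cdot> 2\<^bsup>-kx\<^esup>\<close>; it collects errors over dyadic scales.
\<close>
definition dyadic_sum :: "real \<Rightarrow> real \<Rightarrow> real"
  where "dyadic_sum a x = a / (1 - 2 powr (- x))"

lemma dyadic_sum_unfold:
  assumes "x > 0"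
  shows "dyadic_sum a x = a + dyadic_sum a x * 2 powr (- x)"
proof -
  have "2 powr (- x) < (2::real) powr 0" using assms by (intro powr_less_mono) auto
  then have "dyadic_sum a x * (1 - 2 powr (- x)) = a"
    unfolding dyadic_sum_def by (subst nonzero_eq_divide_eq[symmetric]) auto
  then show ?thesis by (simp add: algebra_simps)
qed

lemma dyadic_sum_ge:
  assumes "x > 0" "a \<ge> 0"
  shows "dyadic_sum a x \<ge> a"
proof -
  have r: "2 powr (- x) < (2::real) powr 0" using assms by (intro powr_less_mono) auto
  then have "a * (1 - 2 powr (- x)) \<le> a * 1" using assms by (intro mult_left_mono) auto
  then show ?thesis using r by (simp add: dyadic_sum_def le_divide_eq)
qed

definition angle_const :: "real \<Rightarrow> real"
  where "angle_const q = dyadic_sum 120 ((q - 2) / (q + 2))"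

definition holder_const :: "real \<Rightarrow> real"
  where "holder_const q = dyadic_sum 64 (1 - 2 / q)"

text \<open>
  Chosen such that \<open>d \<le> range_const q \<cdot> E\<^bsup>-1/(q-2)\<^esup>\<close> makes the relative tube width at scale \<open>2d\<close>, which is
  \<open>(E (2d)\<^bsup>q-2\<^esup>)\<^bsup>1/(q+2)\<^esup>\<close>, at most \<open>1 / (64 \<cdot> angle_const q)\<close>.
\<close>
definition range_const :: "real \<Rightarrow> real"
  where "range_const q = (1 / (64 * angle_const q)) powr ((q + 2) / (q - 2)) / 2"

lemma angle_const_ge: "q > 2 \<Longrightarrow> angle_const q \<ge> 120"
  unfolding angle_const_def by (rule dyadic_sum_ge) auto

lemma holder_const_pos: "q > 2 \<Longrightarrow> holder_const q > 0"
  unfolding holder_const_def using dyadic_sum_ge[of "1 - 2 / q" 64] by simp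

lemma range_const_pos: "q > 2 \<Longrightarrow> range_const q > 0"
  using angle_const_ge[of q] by (simp add: range_const_def)

section \<open>Curves of finite energy\<close>

text \<open>
  \<open>E\<close> is any positive upper bound of the energy, so that the degenerate value zero does not have to be
  singled out.  The complete set \<open>V\<close> contains all difference quotients; it is where tangents are found
  as limits, the ambient inner product space being possibly incomplete.
\<close>
locale finite_energy_curve =
  fixes \<Gamma> :: "real \<Rightarrow> 'a::real_inner" and L q E :: real and V :: "'a set"
  assumes q: "q > 2" and E: "E > 0" and L: "L > 0"
    and periodic: "\<Gamma> (t + L) = \<Gamma> t"
    and inj: "inj_on \<Gamma> {0..<L}"
    and lipschitz: "\<exists>C. \<forall>u v. dist (\<Gamma> u) (\<Gamma> v) \<le> C * \<bar>u - v\<bar>"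
    and unit_speed: "AE t in lborel. \<Gamma> differentiable at t \<and> norm (vector_derivative \<Gamma> (at t)) = 1"
    and energy: "tangent_point_energy q L \<Gamma> \<le> ennreal E"
    and complete: "complete V"
    and V: "c *\<^sub>R (\<Gamma> u - \<Gamma> v) \<in> V"
begin

lemma has_unit_derivative:
  "AE t in lborel. (\<Gamma> has_vector_derivative vector_derivative \<Gamma> (at t)) (at t) \<and> norm (vector_derivative \<Gamma> (at t)) = 1"
  using unit_speed by eventually_elim (simp add: vector_derivative_works)

lemma inner_lipschitz: "\<exists>C. \<forall>x y. \<bar>\<Gamma> x \<bullet> w - \<Gamma> y \<bullet> w\<bar> \<le> C * \<bar>x - y\<bar>"
proof -
  obtain C where C: "\<And>u v. dist (\<Gamma> u) (\<Gamma> v) \<le> C * \<bar>u - v\<bar>" using lipschitz by blast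
  have "\<bar>\<Gamma> x \<bullet> w - \<Gamma> y \<bullet> w\<bar> \<le> (C * norm w) * \<bar>x - y\<bar>" for x y
  proof -
    have "\<bar>\<Gamma> x \<bullet> w - \<Gamma> y \<bullet> w\<bar> \<le> norm (\<Gamma> x - \<Gamma> y) * norm w"
      using Cauchy_Schwarz_ineq2[of "\<Gamma> x - \<Gamma> y" w] by (simp add: inner_diff_left)
    also have "\<dots> \<le> C * \<bar>x - y\<bar> * norm w"
      using C[of x y] by (intro mult_right_mono) (auto simp: dist_norm)
    finally show ?thesis by (simp add: mult_ac)
  qed
  then show ?thesis by blast
qed

text \<open>
  A substitute for the fundamental theorem of calculus, used with bounds on the tangent that hold almost everywhere.
\<close>
lemma inner_increment_ge:
  assumes "AE t in lborel. t \<in> {a<..<b} \<longrightarrow> m \<le> vector_derivative \<Gamma> (at t) \<bullet> w" and "a \<le> b"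
  shows "m * (b - a) \<le> (\<Gamma> b - \<Gamma> a) \<bullet> w"
proof -
  obtain C where C: "\<And>x y. \<bar>\<Gamma> x \<bullet> w - \<Gamma> y \<bullet> w\<bar> \<le> C * \<bar>x - y\<bar>" using inner_lipschitz by blast
  have "AE t in lborel. t \<in> {a<..<b} \<longrightarrow> (\<exists>D. ((\<lambda>x. \<Gamma> x \<bullet> w) has_real_derivative D) (at t) \<and> m \<le> D)"
    using has_unit_derivative assms(1)
  proof eventually_elim
    case (elim t)
    have "((\<lambda>x. \<Gamma> x \<bullet> w) has_vector_derivative (vector_derivative \<Gamma> (at t) \<bullet> w)) (at t)"
      using elim bounded_linear.has_vector_derivative[OF bounded_linear_inner_left] by blast
    then show ?case using elim by (auto simp: has_real_derivative_iff_has_vector_derivative)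
  qed
  from lipschitz_increment_ge[OF C this \<open>a \<le> b\<close>] show ?thesis by (simp add: inner_diff_left)
qed

lemma nonexpansive: "norm (\<Gamma> s - \<Gamma> t) \<le> \<bar>s - t\<bar>"
proof -
  have *: "norm (\<Gamma> b - \<Gamma> a) \<le> b - a" if "a \<le> b" for a b
  proof (cases "\<Gamma> b = \<Gamma> a")
    case False
    define w where "w = - sgn (\<Gamma> b - \<Gamma> a)"
    have w: "norm w = 1" "(\<Gamma> b - \<Gamma> a) \<bullet> w = - norm (\<Gamma> b - \<Gamma> a)"
      using False by (auto simp: w_def norm_sgn sgn_div_norm dot_square_norm power2_eq_square)
    have "AE t in lborel. t \<in> {a<..<b} \<longrightarrow> -1 \<le> vector_derivative \<Gamma> (at t) \<bullet> w"
      using has_unit_derivative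
    proof eventually_elim
      case (elim t)
      then show ?case using Cauchy_Schwarz_ineq2[of "vector_derivative \<Gamma> (at t)" w] w by (auto simp: abs_le_iff)
    qed
    from inner_increment_ge[OF this that] w show ?thesis by simp
  qed (use that in simp)
  show ?thesis using *[of s t] *[of t s] by (cases "s \<le> t") (auto simp: norm_minus_commute)
qed

lemma continuous: "continuous_on A \<Gamma>"
  by (rule lipschitz_on_continuous_on[of 1], rule lipschitz_onI)
    (use nonexpansive in \<open>auto simp: dist_norm\<close>)

lemma periodic_int: "\<Gamma> (t + of_int k * L) = \<Gamma> t"
proof -
  have nat: "\<Gamma> (t + of_nat n * L) = \<Gamma> t" for n t
  proof (induction n)
    case (Suc n)
    have "t + of_nat (Suc n) * L = (t + of_nat n * L) + L" by (simp add: algebra_simps)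
    then show ?case using Suc periodic by metis
  qed simp
  show ?thesis
  proof (cases k)
    case (nonneg n)
    then show ?thesis using nat by simp
  next
    case (neg n)
    then have "of_int k = - real (Suc n)" by simp
    then have "t = (t + of_int k * L) + of_nat (Suc n) * L" by (simp only:)
    then show ?thesis using nat by metis
  qed
qed

lemma period_representative: "\<exists>t'\<in>{0..<L}. \<exists>k::int. t' = t + of_int k * L \<and> \<Gamma> t' = \<Gamma> t"
proof -
  define k where "k = - \<lfloor>t / L\<rfloor>"
  have "of_int \<lfloor>t / L\<rfloor> * L \<le> t"
    using of_int_floor_le[of "t / L"] L by (simp only: pos_le_divide_eq)
  moreover have "t < (of_int \<lfloor>t / L\<rfloor> + 1) * L"
    using real_of_int_floor_add_one_gt[of "t / L"] L by (simp only: pos_divide_less_eq)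
  ultimately have "0 \<le> t + of_int k * L" "t + of_int k * L < L"
    by (auto simp: k_def algebra_simps)
  then show ?thesis using periodic_int[of t k] by auto
qed

lemma noncoincident: "s \<noteq> t \<Longrightarrow> \<bar>s - t\<bar> < L \<Longrightarrow> \<Gamma> s \<noteq> \<Gamma> t"
proof
  assume st: "s \<noteq> t" "\<bar>s - t\<bar> < L" "\<Gamma> s = \<Gamma> t"
  obtain s' k where s': "s' \<in> {0..<L}" "s' = s + of_int k * L" "\<Gamma> s' = \<Gamma> s"
    using period_representative by blast
  obtain t' l where t': "t' \<in> {0..<L}" "t' = t + of_int l * L" "\<Gamma> t' = \<Gamma> t"
    using period_representative by blast
  have "s' = t'" by (rule inj_onD[OF inj]) (use s' t' st in simp_all)
  then have eq: "s - t = of_int (l - k) * L" using s' t' by (simp add: algebra_simps)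
  then have "l - k \<noteq> 0" using st by auto
  then have "\<bar>of_int (l - k)\<bar> \<ge> (1::real)" by (metis of_int_abs of_int_1_le_iff zero_less_abs_iff int_one_le_iff_zero_less)
  then have "\<bar>s - t\<bar> \<ge> L" unfolding eq abs_mult using L by simp
  then show False using st by simp
qed

section \<open>Thin tubes at every scale\<close>

text \<open>
  Two applications of Chebyshev's inequality on intervals of length \<open>a\<close>: one to find \<open>t\<close> near \<open>s\<^sub>0\<close> for
  which the integral over \<open>s\<close> is small, and then, for this \<open>t\<close>, one near every other parameter.
  The condition \<open>2 * a \<le> L\<close> lets every point of the period be one end of an interval of length \<open>a\<close> inside it.
\<close>
lemma good_tangent:
  assumes "0 < a" "2 * a \<le> L"
  shows "\<exists>t. norm (\<Gamma> t - \<Gamma> s0) \<le> a \<and> norm (vector_derivative \<Gamma> (at t)) = 1 \<and>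
    (\<forall>y\<in>range \<Gamma>. \<exists>s. norm (\<Gamma> s - y) \<le> a \<and> tp_kernel q \<Gamma> t s \<le> ennreal (4 * E / a\<^sup>2))"
proof -
  have window: "\<exists>p. s' \<in> {p..p + a} \<and> {p..p + a} \<subseteq> {0..L} \<and> \<Gamma> s' = \<Gamma> s"
    if "s' \<in> {0..<L}" "\<Gamma> s' = \<Gamma> s" for s s'
    using that assms by (intro exI[of _ "if s' + a \<le> L then s' else s' - a"]) auto
  have window: "\<exists>p s'. s' \<in> {p..p + a} \<and> {p..p + a} \<subseteq> {0..L} \<and> \<Gamma> s' = \<Gamma> s" for s
    using period_representative[of s] window by metis
  obtain p s' where p: "s' \<in> {p..p + a}" "{p..p + a} \<subseteq> {0..L}" "\<Gamma> s' = \<Gamma> s0" using window by blast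
  define J where "J t = (\<integral>\<^sup>+s\<in>{0..L}. tp_kernel q \<Gamma> t s \<partial>lborel)" for t
  have "(\<integral>\<^sup>+t\<in>{0..L}. J t \<partial>lborel) \<le> ennreal E"
    using energy by (simp add: J_def tp_kernel_def tangent_point_energy_def)
  from exists_le_of_nn_integral[OF \<open>0 < a\<close> E p(2) this unit_speed]
  obtain t where t: "t \<in> {p..p + a}" "norm (vector_derivative \<Gamma> (at t)) = 1" "J t \<le> ennreal (2 * E / a)"
    by blast
  have "\<exists>s. norm (\<Gamma> s - \<Gamma> s1) \<le> a \<and> tp_kernel q \<Gamma> t s \<le> ennreal (4 * E / a\<^sup>2)" for s1
  proof -
    obtain p' s1' where p': "s1' \<in> {p'..p' + a}" "{p'..p' + a} \<subseteq> {0..L}" "\<Gamma> s1' = \<Gamma> s1" using window by blast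
    have "2 * E / a > 0" using E \<open>0 < a\<close> by simp
    from exists_le_of_nn_integral[OF \<open>0 < a\<close> this p'(2) t(3)[unfolded J_def], of "\<lambda>_. True"]
    obtain s where s: "s \<in> {p'..p' + a}" "tp_kernel q \<Gamma> t s \<le> ennreal (2 * (2 * E / a) / a)" by auto
    have "norm (\<Gamma> s - \<Gamma> s1') \<le> a" using nonexpansive[of s s1'] s p' by auto
    then show ?thesis using s p' by (auto simp: power2_eq_square)
  qed
  moreover have "norm (\<Gamma> t - \<Gamma> s0) \<le> a" using nonexpansive[of t s'] t p by auto
  ultimately show ?thesis using t by blast
qed

text \<open>
  Up to a constant, the relative width of the tubes at scale \<open>h\<close>.  If the window length in \<open>good_tangent\<close> is
  \<open>a = \<epsilon> h\<close>, then a point is moved by up to \<open>\<epsilon> h\<close> before the energy bound applies, and the energy bound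
  itself contributes a multiple of \<open>h\<^sup>2 (E/a\<^sup>2)\<^bsup>1/q\<^esup>\<close>.  The two errors balance exactly for \<open>\<epsilon> = flatness h\<close>.
\<close>
definition flatness :: "real \<Rightarrow> real"
  where "flatness h = (E * h powr (q - 2)) powr (1 / (q + 2))"

lemma flatness_pos: "h > 0 \<Longrightarrow> flatness h > 0"
  using E by (simp add: flatness_def)

lemma flatness_mono: "0 \<le> h \<Longrightarrow> h \<le> h' \<Longrightarrow> flatness h \<le> flatness h'"
  unfolding flatness_def using E q by (intro powr_mono2 mult_left_mono) auto

text \<open>
  As \<open>q > 2\<close>, halving the scale gains a fixed factor less than one.
\<close>
lemma flatness_half: "h > 0 \<Longrightarrow> flatness (h / 2) = 2 powr (- ((q - 2) / (q + 2))) * flatness h"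
  using E q by (simp add: flatness_def powr_mult powr_divide powr_powr powr_minus divide_simps)

lemma flatness_tendsto: "(flatness \<longlongrightarrow> 0) (at_right 0)"
proof -
  have "((\<lambda>h. E * h powr (q - 2)) \<longlongrightarrow> E * 0) (at_right 0)"
    using q by (intro tendsto_mult tendsto_const tendsto_zero_powrI[of _ _ _ "q - 2"] ) (auto simp: eventually_at_filter)
  then have "((\<lambda>h. E * h powr (q - 2)) \<longlongrightarrow> 0) (at_right 0)" by simp
  then have "((\<lambda>h. (E * h powr (q - 2)) powr (1 / (q + 2))) \<longlongrightarrow> 0) (at_right 0)"
    using q E by (intro tendsto_zero_powrI[of _ _ _ "1 / (q + 2)"]) (auto simp: eventually_at_filter)
  then show ?thesis by (simp add: flatness_def[abs_def])
qed

text \<open>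
  The contribution of the energy to the width of the tube at scale \<open>h\<close>, divided by \<open>h\<close>; the factor is \<open>4\<^bsup>1/q\<^esup> \<le> 2\<close>.
\<close>
lemma tube_width:
  assumes "h > 0"
  shows "h * (4 * E / (flatness h * h)\<^sup>2) powr (1 / q) \<le> 2 * flatness h"
proof -
  define e where "e = flatness h"
  have e: "e > 0" using flatness_pos assms by (simp add: e_def)
  have "e powr (q + 2) = E * h powr (q - 2)"
    using E q assms by (simp add: e_def flatness_def powr_powr)
  then have "E * h powr q = e powr (q + 2) * h powr 2"
    using assms by (simp add: powr_diff powr_numeral)
  then have Eq: "E / (e * h)\<^sup>2 = e powr q / h powr q"
    using assms e by (simp add: field_simps powr_add power2_eq_square)
  have "(4 * E / (e * h)\<^sup>2) powr (1 / q) = 4 powr (1 / q) * (e powr q / h powr q) powr (1 / q)"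
    unfolding Eq[symmetric] using E e assms by (simp add: powr_mult[symmetric] del: powr_mult)
  also have "(e powr q / h powr q) powr (1 / q) = e / h"
    using e assms q by (simp add: powr_divide powr_powr)
  finally have "h * (4 * E / (e * h)\<^sup>2) powr (1 / q) = 4 powr (1 / q) * e" using assms by simp
  moreover have "4 powr (1 / q) \<le> (4::real) powr (1 / 2)"
    using q by (intro powr_mono) (auto simp: field_simps)
  moreover have "(4::real) powr (1 / 2) = 2" by (simp add: powr_half_sqrt)
  ultimately show ?thesis using e by (simp add: e_def mult_right_mono)
qed

text \<open>
  The points \<open>y\<close> and \<open>z\<close> are compared with \<open>x\<close> by their distance in space, not along the curve: distant parts of the
  curve that come close to \<open>x\<close> lie in the same tube.
\<close>
lemma tube:
  assumes x: "x \<in> range \<Gamma>" and h: "0 < h" "2 * h \<le> L" "flatness h \<le> 1"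
  shows "\<exists>T. norm T = 1 \<and> (\<forall>y\<in>range \<Gamma>. \<forall>z\<in>range \<Gamma>. norm (y - x) \<le> h \<longrightarrow> norm (z - x) \<le> h \<longrightarrow>
    norm (normal_part T (y - z)) \<le> 20 * flatness h * h)"
proof -
  obtain s0 where s0: "x = \<Gamma> s0" using x by blast
  define a where "a = flatness h * h"
  have "a \<le> 1 * h" unfolding a_def using h by (intro mult_right_mono) auto
  then have a: "0 < a" "a \<le> h" using h flatness_pos by (auto simp: a_def)
  then obtain t where t: "norm (\<Gamma> t - \<Gamma> s0) \<le> a" "norm (vector_derivative \<Gamma> (at t)) = 1"
    and s: "\<And>y. y \<in> range \<Gamma> \<Longrightarrow> \<exists>s. norm (\<Gamma> s - y) \<le> a \<and> tp_kernel q \<Gamma> t s \<le> ennreal (4 * E / a\<^sup>2)"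
    using good_tangent[of a s0] h by auto
  define T where "T = vector_derivative \<Gamma> (at t)"
  have T: "norm T = 1" using t by (simp add: T_def)
  \<comment> \<open>move \<open>y\<close> by at most \<open>a\<close> along the curve to a point that is close to the tangent line at \<open>t\<close>\<close>
  have near: "norm (normal_part T (y - \<Gamma> t)) \<le> 10 * flatness h * h" if y: "y \<in> range \<Gamma>" "norm (y - x) \<le> h" for y
  proof -
    obtain s where s: "norm (\<Gamma> s - y) \<le> a" "tp_kernel q \<Gamma> t s \<le> ennreal (4 * E / a\<^sup>2)" using s y by blast
    have "norm (\<Gamma> s - \<Gamma> t) \<le> norm (\<Gamma> s - y) + norm (y - x) + norm (\<Gamma> t - x)"
      using norm_triangle_ineq[of "\<Gamma> s - y" "(y - x) + (x - \<Gamma> t)"] norm_triangle_ineq[of "y - x" "x - \<Gamma> t"]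
      by (simp add: norm_minus_commute)
    also have "\<dots> \<le> 3 * h" using s t y a s0 by simp
    finally have c: "norm (\<Gamma> s - \<Gamma> t) \<le> 3 * h" .
    have "norm (normal_part T (\<Gamma> s - \<Gamma> t)) \<le> (norm (\<Gamma> s - \<Gamma> t))\<^sup>2 * (4 * E / a\<^sup>2) powr (1 / q) / 2"
      unfolding T_def using t q E s by (intro normal_part_le_of_tp_kernel) auto
    also have "\<dots> \<le> (3 * h)\<^sup>2 * (4 * E / a\<^sup>2) powr (1 / q) / 2"
      using c by (intro divide_right_mono mult_right_mono power_mono) auto
    also have "\<dots> = 9 / 2 * h * (h * (4 * E / a\<^sup>2) powr (1 / q))" by (simp add: power2_eq_square)
    also have "\<dots> \<le> 9 / 2 * h * (2 * flatness h)"
      using tube_width[OF h(1)] h by (intro mult_left_mono) (auto simp: a_def)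
    finally have "norm (normal_part T (\<Gamma> s - \<Gamma> t)) \<le> 9 * flatness h * h" by (simp add: mult_ac)
    moreover have "norm (normal_part T (y - \<Gamma> s)) \<le> flatness h * h"
      using norm_normal_part_le[OF T, of "y - \<Gamma> s"] s by (simp add: norm_minus_commute a_def)
    moreover have "normal_part T (y - \<Gamma> t) = normal_part T (y - \<Gamma> s) + normal_part T (\<Gamma> s - \<Gamma> t)"
      by (simp flip: normal_part_add)
    ultimately show ?thesis using norm_triangle_ineq[of "normal_part T (y - \<Gamma> s)" "normal_part T (\<Gamma> s - \<Gamma> t)"]
      by simp
  qed
  have "norm (normal_part T (y - z)) \<le> 20 * flatness h * h"
    if "y \<in> range \<Gamma>" "z \<in> range \<Gamma>" "norm (y - x) \<le> h" "norm (z - x) \<le> h" for y z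
  proof -
    have "normal_part T (y - z) = normal_part T (y - \<Gamma> t) - normal_part T (z - \<Gamma> t)"
      by (simp flip: normal_part_diff)
    then show ?thesis using near[of y] near[of z] that
        norm_triangle_ineq4[of "normal_part T (y - \<Gamma> t)" "normal_part T (z - \<Gamma> t)"] by simp
  qed
  then show ?thesis using T by blast
qed

section \<open>Absence of thick triangles\<close>

text \<open>
  Both chords lie in the tube around \<open>y\<close>; as they are not short compared with \<open>h\<close>, they are almost parallel to its axis.
\<close>
lemma directions_comparable_scale:
  assumes "y \<in> range \<Gamma>" "x \<in> range \<Gamma>" "z \<in> range \<Gamma>"
    and h: "norm (x - y) = h" "0 < h" "2 * h \<le> L" "flatness h \<le> 1"
    and z: "h / 2 \<le> norm (z - y)" "norm (z - y) \<le> h"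
  shows "almost_parallel (120 * flatness h) (sgn (x - y)) (sgn (z - y))"
proof -
  obtain T where T: "norm T = 1" and tube: "\<And>w w'. w \<in> range \<Gamma> \<Longrightarrow> w' \<in> range \<Gamma> \<Longrightarrow> norm (w - y) \<le> h \<Longrightarrow>
      norm (w' - y) \<le> h \<Longrightarrow> norm (normal_part T (w - w')) \<le> 20 * flatness h * h"
    using tube[OF assms(1) h(2-4)] by blast
  have e: "flatness h > 0" using flatness_pos h by simp
  have "norm (normal_part T (x - y)) \<le> 20 * flatness h * norm (x - y)"
    using tube[of x y] assms by simp
  then have 1: "almost_parallel (2 * (20 * flatness h)) (sgn (x - y)) T"
    using h T by (intro almost_parallel_sgn_axis) auto
  have "norm (normal_part T (z - y)) \<le> 20 * flatness h * h"
    using tube[of z y] assms by simp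
  also have "\<dots> \<le> 40 * flatness h * norm (z - y)" using z e by simp
  finally have 2: "almost_parallel (2 * (40 * flatness h)) (sgn (z - y)) T"
    using h z T by (intro almost_parallel_sgn_axis) auto
  show ?thesis using almost_parallel_trans[OF 1 almost_parallel_sym[OF 2]] by simp
qed

abbreviation "B \<equiv> angle_const q"

lemma B_eq: "B = 120 + B * 2 powr (- ((q - 2) / (q + 2)))"
  unfolding angle_const_def by (rule dyadic_sum_unfold) (use q in simp)

lemma B_ge: "B \<ge> 120"
  using q by (rule angle_const_ge)

text \<open>
  Induction on the number of dyadic scales between the two chords: an intermediate point \<open>x'\<close> of the
  curve at distance \<open>h / 2\<close> from \<open>y\<close> exists by continuity, and the errors form a geometric series with sum
  \<open>B * flatness h\<close>.
\<close>
lemma directions_from_point: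
  assumes "y \<in> range \<Gamma>" "x \<in> range \<Gamma>" "z \<in> range \<Gamma>"
    and h: "norm (x - y) = h" "0 < h" "2 * h \<le> L" "flatness h \<le> 1"
    and z: "z \<noteq> y" "norm (z - y) \<le> h"
  shows "almost_parallel (B * flatness h) (sgn (x - y)) (sgn (z - y))"
proof -
  have "almost_parallel (B * flatness h) (sgn (x - y)) (sgn (z - y))"
    if "norm (x - y) = h" "x \<in> range \<Gamma>" "h / 2 ^ m \<le> norm (z - y)" "norm (z - y) \<le> h" 
       "0 < h" "2 * h \<le> L" "flatness h \<le> 1" for m h x
    using that
  proof (induction m arbitrary: h x)
    case 0
    then have "almost_parallel (120 * flatness h) (sgn (x - y)) (sgn (z - y))"
      using assms by (intro directions_comparable_scale) auto
    then show ?case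
      using B_ge flatness_pos[OF \<open>0 < h\<close>] by (rule_tac almost_parallel_mono) (auto intro: mult_right_mono)
  next
    case (Suc m)
    show ?case
    proof (cases "h / 2 \<le> norm (z - y)")
      case True
      then have "almost_parallel (120 * flatness h) (sgn (x - y)) (sgn (z - y))"
        using Suc assms by (intro directions_comparable_scale) auto
      then show ?thesis
        using B_ge flatness_pos[OF \<open>0 < h\<close>] by (rule_tac almost_parallel_mono) (auto intro: mult_right_mono)
    next
      case False
      have "\<exists>x'\<in>range \<Gamma>. norm (x' - y) = h / 2"
      proof -
        have "connected (range (\<lambda>s. norm (\<Gamma> s - y)))"
          by (intro connected_continuous_image continuous_intros continuous) auto
        moreover have "h \<in> range (\<lambda>s. norm (\<Gamma> s - y))" using Suc.prems by auto
        moreover have "0 \<in> range (\<lambda>s. norm (\<Gamma> s - y))" using assms(1) by (auto simp: image_iff)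
        ultimately have "h / 2 \<in> range (\<lambda>s. norm (\<Gamma> s - y))"
          using connectedD_interval[of _ 0 h "h / 2"] \<open>0 < h\<close> by auto
        then show ?thesis by auto
      qed
      then obtain x' where x': "x' \<in> range \<Gamma>" "norm (x' - y) = h / 2" by blast
      have e: "flatness (h / 2) \<le> flatness h" using \<open>0 < h\<close> by (intro flatness_mono) auto
      have "almost_parallel (B * flatness (h / 2)) (sgn (x' - y)) (sgn (z - y))"
        using Suc.prems False x' e by (intro Suc.IH) auto
      moreover have "almost_parallel (120 * flatness h) (sgn (x - y)) (sgn (x' - y))"
        using Suc.prems x' assms(1) by (intro directions_comparable_scale) auto
      ultimately have "almost_parallel (120 * flatness h + B * flatness (h / 2)) (sgn (x - y)) (sgn (z - y))"
        using almost_parallel_trans by blast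
      moreover have "120 * flatness h + B * flatness (h / 2) = (120 + B * 2 powr (- ((q - 2) / (q + 2)))) * flatness h"
        using flatness_half[OF \<open>0 < h\<close>] by (simp add: algebra_simps)
      ultimately show ?thesis using B_eq by simp
    qed
  qed
  moreover obtain m where "(1 / 2) ^ m < norm (z - y) / h"
    using real_arch_pow_inv[of "norm (z - y) / h" "1 / 2"] z h by auto
  then have "h / 2 ^ m \<le> norm (z - y)" using h by (simp add: field_simps)
  ultimately show ?thesis using h z assms(2) by blast
qed

lemma thin_triangle:
  assumes "y \<in> range \<Gamma>" "x \<in> range \<Gamma>" "z \<in> range \<Gamma>" "x \<noteq> y" "z \<noteq> y"
    and "norm (x - y) \<le> d" "norm (z - y) \<le> d" and d: "2 * d \<le> L" "flatness d \<le> 1"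
  shows "almost_parallel (B * flatness d) (sgn (x - y)) (sgn (z - y))"
proof -
  have *: "almost_parallel (B * flatness d) (sgn (x - y)) (sgn (z - y))"
    if "x \<in> range \<Gamma>" "z \<in> range \<Gamma>" "x \<noteq> y" "z \<noteq> y" "norm (x - y) \<le> d" "norm (z - y) \<le> norm (x - y)" for x z
  proof -
    have e: "flatness (norm (x - y)) \<le> flatness d" using that by (intro flatness_mono) auto
    then have "almost_parallel (B * flatness (norm (x - y))) (sgn (x - y)) (sgn (z - y))"
      using that assms by (intro directions_from_point) auto
    then show ?thesis using e B_ge by (rule_tac almost_parallel_mono) (auto intro: mult_left_mono)
  qed
  show ?thesis
  proof (cases "norm (z - y) \<le> norm (x - y)")
    case True
    then show ?thesis using assms by (intro *) auto
  next
    case False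
    then show ?thesis using assms by (intro almost_parallel_sym[OF *]) auto
  qed
qed

end

context finite_energy_curve begin

section \<open>Short arcs are almost straight\<close>

text \<open>
  Two triangles lead from any chord to the one between the end points: the first shares the vertex \<open>s\<close>, the
  second the vertex \<open>a\<close>.
\<close>
lemma chord_directions:
  assumes "a < b" and d: "2 * (b - a) \<le> L" "flatness (b - a) \<le> 1"
    and st: "s \<in> {a..b}" "t \<in> {a..b}" "s \<noteq> t"
  shows "almost_parallel (2 * B * flatness (b - a)) (sgn (\<Gamma> t - \<Gamma> s)) (sgn (\<Gamma> b - \<Gamma> a))"
proof -
  define d where "d = b - a"
  have Be: "0 \<le> B * flatness d" using flatness_pos[of d] \<open>a < b\<close> B_ge by (simp add: d_def)
  have tri: "almost_parallel (B * flatness d) (sgn (\<Gamma> x - \<Gamma> y)) (sgn (\<Gamma> z - \<Gamma> y))"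
    if "x \<in> {a..b}" "y \<in> {a..b}" "z \<in> {a..b}" "x \<noteq> y" "z \<noteq> y" for x y z
  proof (rule thin_triangle)
    show "\<Gamma> x \<noteq> \<Gamma> y" "\<Gamma> z \<noteq> \<Gamma> y"
      using noncoincident[of x y] noncoincident[of z y] that assms L by (auto simp: abs_less_iff)
    show "norm (\<Gamma> x - \<Gamma> y) \<le> d" "norm (\<Gamma> z - \<Gamma> y) \<le> d"
      using nonexpansive[of x y] nonexpansive[of z y] that by (auto simp: d_def abs_le_iff)
  qed (use d in \<open>auto simp: d_def\<close>)
  have flip: "sgn (\<Gamma> x - \<Gamma> y) = - sgn (\<Gamma> y - \<Gamma> x)" for x y
    by (metis minus_diff_eq sgn_minus)
  have *: "almost_parallel (2 * B * flatness d) (sgn (\<Gamma> t - \<Gamma> s)) (sgn (\<Gamma> b - \<Gamma> a))"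
    if "s \<in> {a..b}" "t \<in> {a..b}" "s \<noteq> t" "s \<noteq> a" for s t
  proof -
    have "almost_parallel (B * flatness d) (sgn (\<Gamma> t - \<Gamma> s)) (sgn (\<Gamma> a - \<Gamma> s))"
      using that \<open>a < b\<close> by (intro tri) auto
    moreover have "almost_parallel (B * flatness d) (sgn (\<Gamma> s - \<Gamma> a)) (sgn (\<Gamma> b - \<Gamma> a))"
      using that \<open>a < b\<close> by (intro tri) auto
    then have "almost_parallel (B * flatness d) (sgn (\<Gamma> a - \<Gamma> s)) (sgn (\<Gamma> b - \<Gamma> a))"
      by (subst flip) simp
    ultimately have "almost_parallel (B * flatness d + B * flatness d) (sgn (\<Gamma> t - \<Gamma> s)) (sgn (\<Gamma> b - \<Gamma> a))"
      by (rule almost_parallel_trans)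
    then show ?thesis by (simp add: mult.assoc)
  qed
  show ?thesis
  proof (cases "s = a")
    case True
    then have "almost_parallel (2 * B * flatness d) (sgn (\<Gamma> s - \<Gamma> t)) (sgn (\<Gamma> b - \<Gamma> a))"
      using st by (intro *) auto
    then show ?thesis unfolding d_def[symmetric] by (subst flip) simp
  next
    case False
    then show ?thesis using st * unfolding d_def[symmetric] by blast
  qed
qed

text \<open>
  The projection \<open>f\<close> of the arc to the direction \<open>e\<close> of its main chord is injective, because no chord is
  perpendicular to \<open>e\<close>.  A continuous injective function with \<open>f a < f b\<close> is increasing, and this removes
  the ambiguity of sign.
\<close>
lemma chords_oriented:
  assumes "a < b" and d: "2 * (b - a) \<le> L" "2 * B * flatness (b - a) \<le> 1 / 2"
    and st: "s \<in> {a..b}" "t \<in> {a..b}" "s < t"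
  shows "norm (sgn (\<Gamma> t - \<Gamma> s) - sgn (\<Gamma> b - \<Gamma> a)) \<le> 2 * B * flatness (b - a)"
proof -
  define \<psi> where "\<psi> = 2 * B * flatness (b - a)"
  define e where "e = sgn (\<Gamma> b - \<Gamma> a)"
  have ep: "flatness (b - a) > 0" using flatness_pos \<open>a < b\<close> by simp
  have "2 * 120 * flatness (b - a) \<le> \<psi>" unfolding \<psi>_def
    using B_ge ep by (intro mult_right_mono) auto
  then have "flatness (b - a) \<le> 1" using d(2)[folded \<psi>_def] ep by linarith
  note ap = chord_directions[OF \<open>a < b\<close> d(1) this, folded \<psi>_def e_def]
  have ne: "\<Gamma> s \<noteq> \<Gamma> t" if "s \<in> {a..b}" "t \<in> {a..b}" "s \<noteq> t" for s t
    using that d L \<open>a < b\<close> by (intro noncoincident) auto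
  have e1: "norm e = 1" using ne[of a b] \<open>a < b\<close> by (auto simp: e_def norm_sgn)
  have psi: "0 \<le> \<psi>" "\<psi> \<le> 1 / 2" using d ep B_ge by (auto simp: \<psi>_def)
  have unit: "norm (sgn (\<Gamma> t - \<Gamma> s)) = 1" if "s \<in> {a..b}" "t \<in> {a..b}" "s \<noteq> t" for s t
    using ne[of s t] that by (simp add: norm_sgn)
  \<comment> \<open>a unit vector that does not point forward along \<open>e\<close> is far from \<open>e\<close>\<close>
  have dev: "norm (v - e) > 1 / 2" if "norm v = 1" "v \<bullet> e \<le> 0" for v
  proof -
    have "(1 / 2)\<^sup>2 < (norm (v - e))\<^sup>2"
      using norm_diff_unit[OF that(1) e1] that(2) by (simp add: power2_eq_square)
    then show ?thesis by (rule power2_less_imp_less) simp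
  qed
  have nz: "sgn (\<Gamma> t - \<Gamma> s) \<bullet> e \<noteq> 0" if "s \<in> {a..b}" "t \<in> {a..b}" "s \<noteq> t" for s t
  proof
    assume "sgn (\<Gamma> t - \<Gamma> s) \<bullet> e = 0"
    then have "norm (sgn (\<Gamma> t - \<Gamma> s) - e) > 1 / 2" "norm (- sgn (\<Gamma> t - \<Gamma> s) - e) > 1 / 2"
      using unit[OF that] dev[of "sgn (\<Gamma> t - \<Gamma> s)"] dev[of "- sgn (\<Gamma> t - \<Gamma> s)"] by simp_all
    moreover have "norm (- sgn (\<Gamma> t - \<Gamma> s) - e) = norm (sgn (\<Gamma> t - \<Gamma> s) + e)"
      by (metis minus_add_distrib norm_minus_cancel diff_conv_add_uminus)
    ultimately show False using ap[OF that] psi by (auto simp: almost_parallel_def)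
  qed
  define f where "f x = \<Gamma> x \<bullet> e" for x
  have scale: "f t - f s = norm (\<Gamma> t - \<Gamma> s) * (sgn (\<Gamma> t - \<Gamma> s) \<bullet> e)" for s t
  proof (cases "\<Gamma> t = \<Gamma> s")
    case False
    then have "\<Gamma> t - \<Gamma> s = norm (\<Gamma> t - \<Gamma> s) *\<^sub>R sgn (\<Gamma> t - \<Gamma> s)" by (simp add: sgn_div_norm)
    then have "(\<Gamma> t - \<Gamma> s) \<bullet> e = norm (\<Gamma> t - \<Gamma> s) * (sgn (\<Gamma> t - \<Gamma> s) \<bullet> e)" by (metis inner_scaleR_left)
    then show ?thesis by (simp add: f_def inner_diff_left)
  qed (simp add: f_def)
  have inj: "inj_on f {a..b}"
  proof (rule inj_onI, rule ccontr)
    fix x y assume xy: "x \<in> {a..b}" "y \<in> {a..b}" "f x = f y" "x \<noteq> y"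
    then show False using scale[of y x] nz[of x y] ne[of x y] by auto
  qed
  have cont: "continuous_on {a..b} f"
    unfolding f_def by (intro continuous_intros continuous)
  have "f a < f b"
  proof -
    have "sgn (\<Gamma> b - \<Gamma> a) \<bullet> e = 1" using e1 by (simp add: e_def norm_eq_1)
    moreover have "norm (\<Gamma> b - \<Gamma> a) > 0" using ne[of a b] \<open>a < b\<close> by auto
    ultimately have "f b - f a > 0" using scale[of b a] by (simp only: mult_1_right)
    then show ?thesis by simp
  qed
  have "f s < f t"
  proof (rule ccontr)
    assume "\<not> f s < f t"
    moreover have "f s \<noteq> f t" using inj_onD[OF inj _ st(1,2)] st(3) by auto
    ultimately have "f t < f s" by simp
    \<comment> \<open>by the intermediate value theorem \<open>f\<close> would take the value \<open>f a\<close> or the value \<open>f t\<close> twice\<close>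
    consider "f t \<le> f a" | "f a < f t" by linarith
    then show False
    proof cases
      case 1
      then have "a < t" using st by simp
      show False
      proof (cases "f t = f a")
        case True
        then show False using inj_onD[OF inj True] st by auto
      next
        case False
        then have "\<exists>x. t \<le> x \<and> x \<le> b \<and> f x = f a"
          using 1 \<open>f a < f b\<close> st cont by (intro IVT') (auto intro: continuous_on_subset)
        then obtain x where "t \<le> x" "x \<le> b" "f x = f a" by blast
        then show False using inj_onD[OF inj, of x a] st by auto
      qed
    next
      case 2
      have "\<exists>x. a \<le> x \<and> x \<le> s \<and> f x = f t"
        using 2 \<open>f t < f s\<close> st cont by (intro IVT') (auto intro: continuous_on_subset)
      then obtain x where "a \<le> x" "x \<le> s" "f x = f t" by blast
      then show False using inj_onD[OF inj, of x t] st by auto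
    qed
  qed
  then have pos: "sgn (\<Gamma> t - \<Gamma> s) \<bullet> e > 0"
    using scale[of t s] zero_less_mult_iff[of "norm (\<Gamma> t - \<Gamma> s)" "sgn (\<Gamma> t - \<Gamma> s) \<bullet> e"] by (simp add: not_less)
  have "norm (- sgn (\<Gamma> t - \<Gamma> s) - e) > 1 / 2"
    using unit[of s t] st pos by (intro dev) auto
  moreover have "norm (- sgn (\<Gamma> t - \<Gamma> s) - e) = norm (sgn (\<Gamma> t - \<Gamma> s) + e)"
    by (metis minus_add_distrib norm_minus_cancel diff_conv_add_uminus)
  ultimately have "norm (sgn (\<Gamma> t - \<Gamma> s) - e) \<le> \<psi>"
    using ap[of s t] st psi by (auto simp: almost_parallel_def)
  then show ?thesis by (simp add: \<psi>_def e_def)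
qed

definition slope :: "real \<Rightarrow> real \<Rightarrow> 'a"
  where "slope s t = (1 / (t - s)) *\<^sub>R (\<Gamma> t - \<Gamma> s)"

lemma slope_commute: "slope s t = slope t s"
proof -
  have "slope t s = (1 / (s - t)) *\<^sub>R - (\<Gamma> t - \<Gamma> s)" by (simp add: slope_def)
  also have "\<dots> = (- (1 / (s - t))) *\<^sub>R (\<Gamma> t - \<Gamma> s)" by (simp only: scaleR_minus_left scaleR_minus_right)
  also have "- (1 / (s - t)) = 1 / (t - s)" by (metis minus_diff_eq minus_divide_right)
  finally show ?thesis by (simp add: slope_def)
qed

lemma slope_in_V: "slope s t \<in> V"
  by (simp add: slope_def V)

lemma has_vector_derivative_slope:
  "(\<Gamma> has_vector_derivative D) (at s) \<longleftrightarrow> ((\<lambda>t. slope s t) \<longlongrightarrow> D) (at s)"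
proof -
  have "norm (slope s t - D) = norm ((\<Gamma> t - \<Gamma> s - (t - s) *\<^sub>R D) /\<^sub>R norm (t - s))" if "t \<noteq> s" for t
  proof -
    have "\<Gamma> t - \<Gamma> s - (t - s) *\<^sub>R D = (t - s) *\<^sub>R (slope s t - D)"
      using that by (simp add: slope_def algebra_simps)
    then show ?thesis using that by (simp add: abs_mult)
  qed
  then have "((\<lambda>t. norm (slope s t - D)) \<longlongrightarrow> 0) (at s) \<longleftrightarrow>
    ((\<lambda>t. norm ((\<Gamma> t - \<Gamma> s - (t - s) *\<^sub>R D) /\<^sub>R norm (t - s))) \<longlongrightarrow> 0) (at s)"
    by (intro filterlim_cong refl) (auto simp: eventually_at_filter)
  then show ?thesis
    unfolding has_vector_derivative_def has_derivative_at_within tendsto_norm_zero_iff LIM_zero_iff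
    by (simp add: bounded_linear_scaleR_left)
qed

text \<open>
  The directions of all chords are close to \<open>e\<close>, hence so is the tangent wherever it exists.  Integrating
  its component along \<open>e\<close> bounds the length of a chord from below by almost the length of the arc.
\<close>
lemma slopes_near_direction:
  assumes "a < b" and d: "2 * (b - a) \<le> L" "2 * B * flatness (b - a) \<le> 1 / 2"
  shows "\<exists>e. norm e = 1 \<and>
    (\<forall>s\<in>{a..b}. \<forall>t\<in>{a..b}. s < t \<longrightarrow> norm (slope s t - e) \<le> 4 * B * flatness (b - a))"
proof (intro exI[of _ "sgn (\<Gamma> b - \<Gamma> a)"] conjI ballI impI)
  define \<psi> where "\<psi> = 2 * B * flatness (b - a)"
  define e where "e = sgn (\<Gamma> b - \<Gamma> a)"
  have ne: "\<Gamma> s \<noteq> \<Gamma> t" if "s \<in> {a..b}" "t \<in> {a..b}" "s \<noteq> t" for s t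
    using that d L \<open>a < b\<close> by (intro noncoincident) auto
  show e1: "norm (sgn (\<Gamma> b - \<Gamma> a)) = 1" using ne[of a b] \<open>a < b\<close> by (auto simp: norm_sgn)
  have psi: "0 \<le> \<psi>" "\<psi> \<le> 1 / 2" using d flatness_pos[of "b - a"] \<open>a < b\<close> B_ge by (auto simp: \<psi>_def)
  have dir: "norm (sgn (\<Gamma> t - \<Gamma> s) - e) \<le> \<psi>" if "s \<in> {a..b}" "t \<in> {a..b}" "s < t" for s t
    unfolding \<psi>_def e_def using that assms by (intro chords_oriented) auto
  fix s t assume st: "s \<in> {a..b}" "t \<in> {a..b}" "s < t"
  have "AE x in lborel. x \<in> {s<..<t} \<longrightarrow> 1 - \<psi> \<le> vector_derivative \<Gamma> (at x) \<bullet> e"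
    using has_unit_derivative
  proof eventually_elim
    case (elim x)
    define D where "D = vector_derivative \<Gamma> (at x)"
    have D: "(\<Gamma> has_vector_derivative D) (at x)" "norm D = 1" using elim by (auto simp: D_def)
    show ?case
    proof
      assume x: "x \<in> {s<..<t}"
      have "((\<lambda>y. slope x y) \<longlongrightarrow> D) (at_right x)"
        using D(1) by (simp add: has_vector_derivative_slope filterlim_at_split)
      then have lim: "((\<lambda>y. sgn (slope x y)) \<longlongrightarrow> D) (at_right x)"
        using tendsto_sgn[of "slope x" D "at_right x"] D(2) by (cases "D = 0") (auto simp: sgn_div_norm)
      have "\<forall>\<^sub>F y in at_right x. norm (sgn (slope x y) - e) \<le> \<psi>"
      proof -
        have "\<forall>\<^sub>F y in at_right x. y < b" using x st by (intro eventually_at_rightI[of x b]) auto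
        moreover have "\<forall>\<^sub>F y in at_right x. x < y" by (simp add: eventually_at_right_less)
        ultimately show ?thesis
        proof eventually_elim
          case (elim y)
          have "sgn (slope x y) = sgn (\<Gamma> y - \<Gamma> x)" using elim by (simp add: slope_def sgn_scaleR)
          then show ?case using dir[of x y] x st elim by auto
        qed
      qed
      then have "norm (D - e) \<le> \<psi>"
        using lim by (intro tendsto_upperbound[of "\<lambda>y. norm (sgn (slope x y) - e)"] tendsto_intros) auto
      then have "(norm (D - e))\<^sup>2 \<le> \<psi>\<^sup>2" by (intro power_mono) auto
      moreover have "\<psi>\<^sup>2 \<le> 2 * \<psi>" using psi by (simp add: power2_eq_square mult_right_mono)
      ultimately show "1 - \<psi> \<le> vector_derivative \<Gamma> (at x) \<bullet> e"
        using norm_diff_unit[of D e] D(2) e1 by (simp add: e_def D_def)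
    qed
  qed
  then have "(1 - \<psi>) * (t - s) \<le> (\<Gamma> t - \<Gamma> s) \<bullet> e" using st by (intro inner_increment_ge) auto
  also have "\<dots> \<le> norm (\<Gamma> t - \<Gamma> s)" using norm_cauchy_schwarz[of "\<Gamma> t - \<Gamma> s" e] e1 by (simp add: e_def)
  finally have low: "1 - \<psi> \<le> norm (\<Gamma> t - \<Gamma> s) / (t - s)" using st by (simp add: field_simps)
  have up: "norm (\<Gamma> t - \<Gamma> s) / (t - s) \<le> 1" using nonexpansive[of t s] st by (simp add: field_simps)
  have "slope s t = (norm (\<Gamma> t - \<Gamma> s) / (t - s)) *\<^sub>R sgn (\<Gamma> t - \<Gamma> s)"
    using ne[of s t] st by (simp add: slope_def sgn_div_norm)
  then have "slope s t - sgn (\<Gamma> t - \<Gamma> s) = (norm (\<Gamma> t - \<Gamma> s) / (t - s) - 1) *\<^sub>R sgn (\<Gamma> t - \<Gamma> s)"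
    by (simp add: algebra_simps)
  then have "norm (slope s t - sgn (\<Gamma> t - \<Gamma> s)) \<le> \<psi>"
    using low up ne[of s t] st by (simp add: norm_sgn)
  then have "norm (slope s t - e) \<le> \<psi> + \<psi>"
    using dir[OF st] norm_triangle_ineq[of "slope s t - sgn (\<Gamma> t - \<Gamma> s)" "sgn (\<Gamma> t - \<Gamma> s) - e"] by simp
  then show "norm (slope s t - sgn (\<Gamma> b - \<Gamma> a)) \<le> 4 * B * flatness (b - a)" by (simp add: \<psi>_def e_def)
qed

section \<open>Continuous differentiability\<close>

text \<open>
  The bound \<open>1 / 32\<close> keeps all difference quotients on an interval of length \<open>h\<close> within
  \<open>8 * B * flatness h \<le> 1 / 8\<close> of each other, so that none of them is perpendicular or opposite to a tangent.
\<close>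
abbreviation "small_scale h \<equiv> 2 * h \<le> L \<and> 2 * B * flatness h \<le> 1 / 32"

lemma slopes_near_each_other:
  assumes "0 < h" "small_scale (2 * h)"
    and "s \<in> {x - h..x + h}" "t \<in> {x - h..x + h}" "s \<noteq> t"
    and "s' \<in> {x - h..x + h}" "t' \<in> {x - h..x + h}" "s' \<noteq> t'"
  shows "norm (slope s t - slope s' t') \<le> 8 * B * flatness (2 * h)"
proof -
  have "\<exists>e. norm e = 1 \<and> (\<forall>s\<in>{x - h..x + h}. \<forall>t\<in>{x - h..x + h}. s < t \<longrightarrow>
      norm (slope s t - e) \<le> 4 * B * flatness ((x + h) - (x - h)))"
    using assms(1,2) by (intro slopes_near_direction) (auto simp: algebra_simps)
  moreover have "(x + h) - (x - h) = 2 * h" by simp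
  ultimately obtain e where e: "\<And>s t. s \<in> {x - h..x + h} \<Longrightarrow> t \<in> {x - h..x + h} \<Longrightarrow> s < t \<Longrightarrow> norm (slope s t - e) \<le> 4 * B * flatness (2 * h)"
    by metis
  have "norm (slope s t - e) \<le> 4 * B * flatness (2 * h)"
    using e[of s t] e[of t s] assms(3-5) slope_commute[of s t] by (cases "s < t") auto
  moreover have "norm (slope s' t' - e) \<le> 4 * B * flatness (2 * h)"
    using e[of s' t'] e[of t' s'] assms(6-8) slope_commute[of s' t'] by (cases "s' < t'") auto
  ultimately show ?thesis using norm_triangle_ineq4[of "slope s t - e" "slope s' t' - e"] by simp
qed

lemma eventually_small:
  assumes "r > 0"
  obtains h0 where "h0 > 0" "\<And>h. 0 < h \<Longrightarrow> h \<le> h0 \<Longrightarrow> 2 * h \<le> r \<and> B * flatness h \<le> r"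
proof -
  have "((\<lambda>h. B * flatness h) \<longlongrightarrow> B * 0) (at_right 0)" by (intro tendsto_intros flatness_tendsto)
  then have "\<forall>\<^sub>F h in at_right 0. B * flatness h < r" using assms by (intro order_tendstoD) auto
  moreover have "\<forall>\<^sub>F h in at_right 0. h < r / 2" using assms by (intro eventually_at_rightI[of _ "r / 2"]) auto
  ultimately have "\<forall>\<^sub>F h in at_right 0. 2 * h \<le> r \<and> B * flatness h \<le> r" by eventually_elim auto
  then obtain b where b: "b > 0" "\<And>h. 0 < h \<Longrightarrow> h < b \<Longrightarrow> 2 * h \<le> r \<and> B * flatness h \<le> r"
    unfolding eventually_at_right_field by blast
  show ?thesis using b by (intro that[of "b / 2"]) auto
qed

text \<open>
  The difference quotients on an interval of length \<open>2 * h\<close> around \<open>x\<close> are within \<open>8 * B * flatness (2 * h)\<close> of each other.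
  They have a limit as \<open>h\<close> tends to zero because \<open>V\<close> is complete, and this bound passes to the limit.
\<close>
lemma differentiable_everywhere:
  shows "(\<Gamma> has_vector_derivative vector_derivative \<Gamma> (at x)) (at x)"
    and "0 < h \<Longrightarrow> small_scale (2 * h) \<Longrightarrow> s \<in> {x - h..x + h} \<Longrightarrow> t \<in> {x - h..x + h} \<Longrightarrow> s \<noteq> t \<Longrightarrow>
      norm (slope s t - vector_derivative \<Gamma> (at x)) \<le> 8 * B * flatness (2 * h)"
proof -
  have small: "\<exists>h>0. small_scale (2 * h) \<and> 8 * B * flatness (2 * h) < r" if "r > 0" for r
  proof -
    define r' where "r' = min L (min (1 / 64) (r / 16))"
    have r': "r' > 0" using L \<open>r > 0\<close> by (simp add: r'_def)
    obtain h0 where h0: "h0 > 0" "\<And>h. 0 < h \<Longrightarrow> h \<le> h0 \<Longrightarrow> 2 * h \<le> r' \<and> B * flatness h \<le> r'"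
      using eventually_small[OF r'] by blast
    show ?thesis using h0(1) h0(2)[of h0] \<open>r > 0\<close> by (intro exI[of _ "h0 / 2"]) (auto simp: r'_def)
  qed
  have "\<exists>D. (slope x \<longlongrightarrow> D) (at x)"
  proof -
    define u where "u n = slope x (x + 1 / real (Suc n))" for n
    have near: "\<exists>h>0. \<forall>n. 1 / real (Suc n) \<le> h \<longrightarrow> (\<forall>t. t \<noteq> x \<longrightarrow> \<bar>t - x\<bar> \<le> h \<longrightarrow> norm (slope x t - u n) < r)" if r: "r > 0" for r
    proof -
      obtain h where h: "h > 0" "small_scale (2 * h)" "8 * B * flatness (2 * h) < r" using small[OF r] by blast
      have "norm (slope x t - u n) < r" if "1 / real (Suc n) \<le> h" "t \<noteq> x" "\<bar>t - x\<bar> \<le> h" for n t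
      proof -
        have "0 < 1 / real (Suc n)" by simp
        then have pos: "0 < 1 / real (Suc n)" "- h \<le> 1 / real (Suc n)" using h(1) by linarith+
        have "norm (slope x t - u n) \<le> 8 * B * flatness (2 * h)" unfolding u_def
          using that h pos by (intro slopes_near_each_other[where x = x]) (auto simp: abs_le_iff simp del: of_nat_Suc)
        then show ?thesis using h by simp
      qed
      then show ?thesis using h by blast
    qed
    have inv: "\<exists>N. \<forall>n\<ge>N. 1 / real (Suc n) \<le> h" if h: "h > 0" for h
    proof -
      obtain N where "1 / real (Suc N) < h" using nat_approx_posE[OF h] by blast
      then have "1 / real (Suc n) \<le> h" if "n \<ge> N" for n
        using that by (rule_tac order_trans[of _ "1 / real (Suc N)"]) (auto simp: frac_le)
      then show ?thesis by blast
    qed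
    have "Cauchy u"
    proof (rule CauchyI)
      fix r :: real assume "r > 0"
      then obtain h where h: "h > 0" "\<And>n t. 1 / real (Suc n) \<le> h \<Longrightarrow> t \<noteq> x \<Longrightarrow> \<bar>t - x\<bar> \<le> h \<Longrightarrow> norm (slope x t - u n) < r"
        using near by metis
      obtain N where N: "\<And>n. n \<ge> N \<Longrightarrow> 1 / real (Suc n) \<le> h" using inv[OF h(1)] by blast
      have "norm (u m - u n) < r" if "m \<ge> N" "n \<ge> N" for m n
        using h(2)[of n "x + 1 / real (Suc m)"] N[of m] N[of n] that by (auto simp: u_def)
      then show "\<exists>M. \<forall>m\<ge>M. \<forall>n\<ge>M. norm (u m - u n) < r" by blast
    qed
    moreover have "u n \<in> V" for n by (simp add: u_def slope_in_V)
    ultimately obtain D where D: "u \<longlonglongrightarrow> D"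
      using complete[unfolded complete_def, rule_format, of u] by blast
    have "(slope x \<longlongrightarrow> D) (at x)"
    proof (rule LIM_I)
      fix r :: real assume "r > 0"
      then obtain h where h: "h > 0" "\<And>n t. 1 / real (Suc n) \<le> h \<Longrightarrow> t \<noteq> x \<Longrightarrow> \<bar>t - x\<bar> \<le> h \<Longrightarrow> norm (slope x t - u n) < r / 2"
        using near[of "r / 2"] by auto
      obtain N where N: "\<And>n. n \<ge> N \<Longrightarrow> 1 / real (Suc n) \<le> h" using inv[OF h(1)] by blast
      have lim: "norm (slope x t - D) \<le> r / 2" if "t \<noteq> x" "\<bar>t - x\<bar> \<le> h" for t
      proof (rule tendsto_upperbound)
        show "(\<lambda>n. norm (slope x t - u n)) \<longlonglongrightarrow> norm (slope x t - D)" by (intro tendsto_intros D)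
        show "\<forall>\<^sub>F n in sequentially. norm (slope x t - u n) \<le> r / 2"
          unfolding eventually_sequentially using h(2) N that by (meson less_imp_le)
      qed simp
      then show "\<exists>s>0. \<forall>t. t \<noteq> x \<and> norm (t - x) < s \<longrightarrow> norm (slope x t - D) < r"
      proof (intro exI[of _ h] conjI allI impI)
        fix t assume "t \<noteq> x \<and> norm (t - x) < h"
        then have "norm (slope x t - D) \<le> r / 2" using lim by simp
        then show "norm (slope x t - D) < r" using \<open>r > 0\<close> by simp
      qed (rule h(1))
    qed
    then show ?thesis by blast
  qed
  then obtain D where D: "(slope x \<longlongrightarrow> D) (at x)" by blast
  then have "(\<Gamma> has_vector_derivative D) (at x)" by (simp add: has_vector_derivative_slope)
  then show "(\<Gamma> has_vector_derivative vector_derivative \<Gamma> (at x)) (at x)"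
    by (metis vector_derivative_at)
  then have lim: "(slope x \<longlongrightarrow> vector_derivative \<Gamma> (at x)) (at x)" by (simp add: has_vector_derivative_slope)
  show "norm (slope s t - vector_derivative \<Gamma> (at x)) \<le> 8 * B * flatness (2 * h)"
    if "0 < h" "small_scale (2 * h)" "s \<in> {x - h..x + h}" "t \<in> {x - h..x + h}" "s \<noteq> t" for s t h
  proof (rule tendsto_upperbound)
    show "((\<lambda>y. norm (slope s t - slope x y)) \<longlongrightarrow> norm (slope s t - vector_derivative \<Gamma> (at x))) (at x)"
      by (intro tendsto_intros lim)
    have "norm (slope s t - slope x y) \<le> 8 * B * flatness (2 * h)" if "y \<noteq> x" "dist y x < h" for y
      using that \<open>0 < h\<close> \<open>small_scale (2 * h)\<close> \<open>s \<in> _\<close> \<open>t \<in> _\<close> \<open>s \<noteq> t\<close>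
      by (intro slopes_near_each_other[where x = x]) (auto simp: dist_real_def)
    then show "\<forall>\<^sub>F y in at x. norm (slope s t - slope x y) \<le> 8 * B * flatness (2 * h)"
      using \<open>0 < h\<close> unfolding eventually_at by blast
  qed simp
qed

lemma slope_derivative:
  assumes "s \<noteq> t" "small_scale (2 * \<bar>s - t\<bar>)"
  shows "norm (slope s t - vector_derivative \<Gamma> (at s)) \<le> 8 * B * flatness (2 * \<bar>s - t\<bar>)"
  using assms by (intro differentiable_everywhere(2)) auto

lemma derivative_near:
  assumes "s \<noteq> t" "small_scale (2 * \<bar>s - t\<bar>)"
  shows "norm (vector_derivative \<Gamma> (at s) - vector_derivative \<Gamma> (at t)) \<le> 16 * B * flatness (2 * \<bar>s - t\<bar>)"
proof -
  have "norm (slope s t - vector_derivative \<Gamma> (at t)) \<le> 8 * B * flatness (2 * \<bar>s - t\<bar>)"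
    using slope_derivative[of t s] assms by (simp add: slope_commute abs_minus_commute)
  then show ?thesis
    using slope_derivative[OF assms] norm_triangle_ineq4[of "slope s t - vector_derivative \<Gamma> (at t)" "slope s t - vector_derivative \<Gamma> (at s)"]
    by simp
qed

lemma continuous_derivative: "continuous_on UNIV (\<lambda>t. vector_derivative \<Gamma> (at t))"
  unfolding continuous_on_iff
proof (intro ballI allI impI)
  fix x r :: real assume "r > 0"
  define r' where "r' = min L (min (1 / 64) (r / 32))"
  have r': "r' > 0" using L \<open>r > 0\<close> by (simp add: r'_def)
  obtain h0 where h0: "h0 > 0" "\<And>h. 0 < h \<Longrightarrow> h \<le> h0 \<Longrightarrow> 2 * h \<le> r' \<and> B * flatness h \<le> r'"
    using eventually_small[OF r'] by blast
  have "dist (vector_derivative \<Gamma> (at y)) (vector_derivative \<Gamma> (at x)) < r" if "dist y x < h0 / 2" for y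
  proof (cases "y = x")
    case False
    have "2 * (2 * \<bar>y - x\<bar>) \<le> r' \<and> B * flatness (2 * \<bar>y - x\<bar>) \<le> r'"
      using False that by (intro h0(2)) (auto simp: dist_real_def)
    then have "norm (vector_derivative \<Gamma> (at y) - vector_derivative \<Gamma> (at x)) \<le> 16 * r'" "16 * r' < r"
      using derivative_near[of y x] False \<open>r > 0\<close> by (auto simp: r'_def)
    then show ?thesis by (simp add: dist_norm)
  qed (use \<open>r > 0\<close> in simp)
  then show "\<exists>d>0. \<forall>y\<in>UNIV. dist y x < d \<longrightarrow> dist (vector_derivative \<Gamma> (at y)) (vector_derivative \<Gamma> (at x)) < r"
    using h0(1) by (intro exI[of _ "h0 / 2"]) auto
qed

text \<open>
  The norm of the derivative is continuous and equal to one almost everywhere.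
\<close>
lemma norm_derivative: "norm (vector_derivative \<Gamma> (at t)) = 1"
proof (rule ccontr)
  assume "norm (vector_derivative \<Gamma> (at t)) \<noteq> 1"
  have cont: "continuous_on UNIV (\<lambda>t. norm (vector_derivative \<Gamma> (at t)))"
    by (intro continuous_intros continuous_derivative)
  define U where "U = {t. norm (vector_derivative \<Gamma> (at t)) \<noteq> 1}"
  have "open U" unfolding U_def by (intro open_Collect_neq cont continuous_on_const)
  moreover have "U \<noteq> {}" using \<open>norm _ \<noteq> 1\<close> by (auto simp: U_def)
  ultimately have "\<not> negligible U" by (rule open_not_negligible)
  moreover have "AE t in lebesgue. t \<notin> U"
    using AE_completion[OF has_unit_derivative] by eventually_elim (auto simp: U_def)
  then have "U \<in> null_sets lebesgue" by (subst completion.null_sets_iff_AE) auto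
  ultimately show False by (simp add: negligible_iff_null_sets)
qed

end

section \<open>The Hoelder estimate on an arc\<close>

text \<open>
  Chebyshev's inequality for the sum of the normalised functions \<open>f / m\<close> and \<open>g / m'\<close>.
\<close>
lemma exists_le_of_two_nn_integrals:
  fixes f g :: "real \<Rightarrow> ennreal"
  assumes [measurable]: "f \<in> borel_measurable lborel" "g \<in> borel_measurable lborel" "X \<in> sets lborel"
    and "0 < a" "0 < m" "0 < m'" and sub: "{p..p + a} \<subseteq> X"
    and f: "(\<integral>\<^sup>+t\<in>X. f t \<partial>lborel) \<le> ennreal m"
    and g: "(\<integral>\<^sup>+t\<in>X. g t \<partial>lborel) \<le> ennreal m'"
  shows "\<exists>t\<in>{p..p + a}. f t \<le> ennreal (4 * m / a) \<and> g t \<le> ennreal (4 * m' / a)"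
proof -
  define h where "h t = ennreal (1 / m) * f t + ennreal (1 / m') * g t" for t
  have "(\<integral>\<^sup>+t\<in>X. h t \<partial>lborel) =
      ennreal (1 / m) * (\<integral>\<^sup>+t\<in>X. f t \<partial>lborel) + ennreal (1 / m') * (\<integral>\<^sup>+t\<in>X. g t \<partial>lborel)"
    unfolding h_def distrib_right mult.assoc
    by (simp add: nn_integral_add nn_integral_cmult)
  also have "\<dots> \<le> ennreal (1 / m) * ennreal m + ennreal (1 / m') * ennreal m'"
    using f g by (intro add_mono mult_left_mono) auto
  also have "\<dots> = ennreal 2"
    using \<open>0 < m\<close> \<open>0 < m'\<close> by (simp flip: ennreal_mult ennreal_plus)
  finally obtain t where t: "t \<in> {p..p + a}" "h t \<le> ennreal (4 / a)"
    using exists_le_of_nn_integral[OF \<open>0 < a\<close> _ sub, of 2 h "\<lambda>_. True"] by auto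
  have *: "x \<le> ennreal (4 * k / a)" if "ennreal (1 / k) * x \<le> ennreal (4 / a)" "0 < k" for x k
  proof -
    have "x = ennreal k * (ennreal (1 / k) * x)"
      using \<open>0 < k\<close> by (simp add: mult.assoc[symmetric] flip: ennreal_mult)
    also have "\<dots> \<le> ennreal k * ennreal (4 / a)" using that by (intro mult_left_mono) auto
    also have "\<dots> = ennreal (4 * k / a)" using that \<open>0 < a\<close> by (simp flip: ennreal_mult add: mult.commute)
    finally show ?thesis .
  qed
  have "f t \<le> ennreal (4 * m / a)"
    by (rule *[OF order_trans[OF _ t(2)] \<open>0 < m\<close>]) (simp add: h_def)
  moreover have "g t \<le> ennreal (4 * m' / a)"
    by (rule *[OF order_trans[OF _ t(2)] \<open>0 < m'\<close>]) (simp add: h_def)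
  ultimately show ?thesis using t by blast
qed

text \<open>
  Here \<open>c\<close> is nearly \<open>\<alpha> A\<close> and nearly \<open>\<beta> B\<close> with \<open>\<alpha>, \<beta> \<ge> 1/2\<close>; comparing lengths shows that \<open>\<alpha>\<close> and \<open>\<beta>\<close>
  are close to each other.
\<close>
lemma unit_vectors_near_of_normal_parts:
  fixes A B c :: "'a::real_inner"
  assumes A: "norm A = 1" "norm (c - A) \<le> 1 / 2" "norm (normal_part A c) \<le> x"
    and B: "norm B = 1" "norm (c - B) \<le> 1 / 2" "norm (normal_part B c) \<le> x"
  shows "norm (A - B) \<le> 8 * x"
proof -
  have half: "1 / 2 \<le> c \<bullet> D" if "norm D = 1" "norm (c - D) \<le> 1 / 2" for D
  proof -
    have "c \<bullet> D = 1 + (c - D) \<bullet> D" using that by (simp add: algebra_simps norm_eq_1)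
    moreover have "\<bar>(c - D) \<bullet> D\<bar> \<le> 1 / 2" using Cauchy_Schwarz_ineq2[of "c - D" D] that by simp
    ultimately show ?thesis by linarith
  qed
  define \<alpha> \<beta> where "\<alpha> = c \<bullet> A" and "\<beta> = c \<bullet> B"
  have ab: "1 / 2 \<le> \<alpha>" "1 / 2 \<le> \<beta>" using half A B by (auto simp: \<alpha>_def \<beta>_def)
  have "\<alpha> *\<^sub>R A - \<beta> *\<^sub>R B = normal_part B c - normal_part A c"
    by (simp add: normal_part_def \<alpha>_def \<beta>_def)
  then have 1: "norm (\<alpha> *\<^sub>R A - \<beta> *\<^sub>R B) \<le> 2 * x"
    using A B norm_triangle_ineq4[of "normal_part B c" "normal_part A c"] by simp
  then have 2: "\<bar>\<alpha> - \<beta>\<bar> \<le> 2 * x"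
    using norm_triangle_ineq3[of "\<alpha> *\<^sub>R A" "\<beta> *\<^sub>R B"] A B ab by simp
  have "\<alpha> * norm (A - B) = norm (\<alpha> *\<^sub>R (A - B))" using ab by simp
  also have "\<alpha> *\<^sub>R (A - B) = (\<alpha> *\<^sub>R A - \<beta> *\<^sub>R B) - (\<alpha> - \<beta>) *\<^sub>R B" by (simp add: algebra_simps)
  also have "norm \<dots> \<le> norm (\<alpha> *\<^sub>R A - \<beta> *\<^sub>R B) + \<bar>\<alpha> - \<beta>\<bar> * norm B"
    using norm_triangle_ineq4[of "\<alpha> *\<^sub>R A - \<beta> *\<^sub>R B" "(\<alpha> - \<beta>) *\<^sub>R B"] by simp
  finally have "\<alpha> * norm (A - B) \<le> 4 * x" using 1 2 B by simp
  moreover have "1 / 2 * norm (A - B) \<le> \<alpha> * norm (A - B)" using ab by (intro mult_right_mono) auto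
  ultimately show ?thesis by simp
qed

context finite_energy_curve begin

abbreviation "T t \<equiv> vector_derivative \<Gamma> (at t)"

text \<open>
  The tangent being continuous by now, the density is an explicit Borel function of both parameters.
\<close>
lemma measurable_tp_kernel: "(\<lambda>(t, s). tp_kernel q \<Gamma> t s) \<in> borel_measurable (lborel \<Otimes>\<^sub>M lborel)"
proof -
  define N :: "real \<times> real \<Rightarrow> real" where "N p = norm (\<Gamma> (snd p) - \<Gamma> (fst p))" for p
  define D where "D p = norm (normal_part (T (fst p)) (\<Gamma> (snd p) - \<Gamma> (fst p)))" for p
  have "continuous_on UNIV N" unfolding N_def
    by (intro continuous_intros continuous_on_compose2[OF continuous[of UNIV]]) auto
  then have [measurable]: "N \<in> borel_measurable (lborel \<Otimes>\<^sub>M lborel)"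
    by (simp add: lborel_prod borel_measurable_continuous_onI)
  have "continuous_on UNIV D" unfolding D_def normal_part_def
    by (intro continuous_intros continuous_on_compose2[OF continuous[of UNIV]]
        continuous_on_compose2[OF continuous_derivative]) auto
  then have [measurable]: "D \<in> borel_measurable (lborel \<Otimes>\<^sub>M lborel)"
    by (simp add: lborel_prod borel_measurable_continuous_onI)
  have eq: "(\<lambda>(t, s). tp_kernel q \<Gamma> t s) = (\<lambda>p. if N p = 0 then top else ennreal ((2 * D p / (N p)\<^sup>2) powr q))"
    using q by (auto simp: fun_eq_iff tp_kernel_eq[OF norm_derivative] N_def D_def)
  show ?thesis unfolding eq by measurable
qed

lemma measurable_tp_kernel2 [measurable]:
  "tp_kernel q \<Gamma> t \<in> borel_measurable lborel" "(\<lambda>s. tp_kernel q \<Gamma> s t) \<in> borel_measurable lborel"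
  using measurable_Pair2[OF measurable_tp_kernel, of t] measurable_Pair1[OF measurable_tp_kernel, of t] by auto

lemma kernel_integral_swap:
  assumes [measurable]: "X \<in> sets lborel"
  shows "(\<integral>\<^sup>+t\<in>X. (\<integral>\<^sup>+s\<in>X. tp_kernel q \<Gamma> t s \<partial>lborel) \<partial>lborel) =
    (\<integral>\<^sup>+t\<in>X. (\<integral>\<^sup>+s\<in>X. tp_kernel q \<Gamma> s t \<partial>lborel) \<partial>lborel)"
proof -
  note [measurable] = measurable_tp_kernel
  have "(\<integral>\<^sup>+t\<in>X. (\<integral>\<^sup>+s\<in>X. tp_kernel q \<Gamma> t s \<partial>lborel) \<partial>lborel) =
      (\<integral>\<^sup>+t. (\<integral>\<^sup>+s. tp_kernel q \<Gamma> t s * indicator X s * indicator X t \<partial>lborel) \<partial>lborel)"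
    by (subst nn_integral_multc) auto
  also have "\<dots> = (\<integral>\<^sup>+s. (\<integral>\<^sup>+t. tp_kernel q \<Gamma> t s * indicator X s * indicator X t \<partial>lborel) \<partial>lborel)"
    by (rule lborel_pair.Fubini'[symmetric]) measurable
  also have "\<dots> = (\<integral>\<^sup>+s\<in>X. (\<integral>\<^sup>+t\<in>X. tp_kernel q \<Gamma> t s \<partial>lborel) \<partial>lborel)"
    by (subst nn_integral_multc[symmetric]) (auto simp: mult_ac intro!: nn_integral_cong)
  finally show ?thesis .
qed

text \<open>
  The chord between \<open>\<Gamma> t\<close> and \<open>\<Gamma> s\<close> makes an angle with each of the two tangents whose sine is half the
  length of the chord divided by the tangent-point radius there.
\<close>
lemma derivative_increment_le:
  assumes "s \<noteq> t" "small_scale (2 * \<bar>s - t\<bar>)" "M \<ge> 0"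
    and K: "tp_kernel q \<Gamma> t s \<le> ennreal M" "tp_kernel q \<Gamma> s t \<le> ennreal M"
  shows "norm (T t - T s) \<le> 4 * \<bar>s - t\<bar> * M powr (1 / q)"
proof -
  define x where "x = \<bar>s - t\<bar> * M powr (1 / q) / 2"
  have normal: "norm (normal_part (T t) (slope t s)) \<le> \<bar>s - t\<bar> * M powr (1 / q) / 2"
    if "tp_kernel q \<Gamma> t s \<le> ennreal M" "s \<noteq> t" for s t
  proof -
    have "norm (normal_part (T t) (\<Gamma> s - \<Gamma> t)) \<le> (norm (\<Gamma> s - \<Gamma> t))\<^sup>2 * M powr (1 / q) / 2"
      using q that \<open>M \<ge> 0\<close> norm_derivative by (intro normal_part_le_of_tp_kernel) auto
    also have "\<dots> \<le> \<bar>s - t\<bar>\<^sup>2 * M powr (1 / q) / 2"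
      using nonexpansive[of s t] by (intro divide_right_mono mult_right_mono power_mono) auto
    finally have "norm (normal_part (T t) (\<Gamma> s - \<Gamma> t)) / \<bar>s - t\<bar> \<le> \<bar>s - t\<bar>\<^sup>2 * M powr (1 / q) / 2 / \<bar>s - t\<bar>"
      by (intro divide_right_mono) auto
    also have "\<dots> = \<bar>s - t\<bar> * M powr (1 / q) / 2" using \<open>s \<noteq> t\<close> by (simp add: power2_eq_square del: abs_mult_self_eq)
    finally show ?thesis by (simp only: slope_def normal_part_scaleR norm_scaleR) simp
  qed
  have close: "norm (slope t s - T t) \<le> 1 / 2" if "small_scale (2 * \<bar>s - t\<bar>)" "s \<noteq> t" for s t
    using slope_derivative[of t s] that by (simp add: abs_minus_commute)
  have "norm (T t - T s) \<le> 8 * x"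
  proof (rule unit_vectors_near_of_normal_parts)
    show "norm (slope t s - T t) \<le> 1 / 2" "norm (slope t s - T s) \<le> 1 / 2"
      using close[of s t] close[of t s] assms by (auto simp: abs_minus_commute slope_commute)
    show "norm (normal_part (T t) (slope t s)) \<le> x" "norm (normal_part (T s) (slope t s)) \<le> x"
      using normal[of t s] normal[of s t] assms by (auto simp: abs_minus_commute slope_commute x_def)
  qed (simp_all add: norm_derivative)
  then show ?thesis by (simp add: x_def)
qed

abbreviation "C \<equiv> holder_const q"

lemma C_eq: "C = 64 + C * 2 powr (- (1 - 2 / q))"
  unfolding holder_const_def by (rule dyadic_sum_unfold) (use q in simp)

lemma C_pos: "C > 0"
  using q by (rule holder_const_pos)

text \<open>
  Let \<open>J t\<close> be the integral over the arc \<open>I\<close> of the density symmetrised in its two parameters, so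
  that \<open>J\<close> has integral at most \<open>2M\<close>.  Given \<open>t\<close> at distance at most \<open>\<rho>\<close> from \<open>w\<close> with
  \<open>J t \<le> 8M/\<rho>\<close>, there is \<open>t1\<close> at distance at most \<open>\<rho>/2\<close> from \<open>w\<close> which satisfies
  \<open>J t1 \<le> 8M/(\<rho>/2)\<close> and for which the symmetrised density at \<open>t\<close> and \<open>t1\<close> is at most \<open>64M/\<rho>\<^sup>2\<close>;
  the tangents at \<open>t\<close> and \<open>t1\<close> then differ by at most \<open>64 M\<^bsup>1/q\<^esup> \<rho>\<^bsup>1-2/q\<^esup>\<close>.  Iteration leads from one
  common starting point \<open>t0\<close> to parameters arbitrarily close to \<open>u\<close> and to \<open>v\<close>, with errors that
  form a convergent geometric series.
\<close>
lemma derivative_holder_positive: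
  assumes "u < v" and small: "small_scale (2 * (v - u))" and "M > 0"
    and energy: "(\<integral>\<^sup>+t\<in>{u..v}. (\<integral>\<^sup>+s\<in>{u..v}. tp_kernel q \<Gamma> s t \<partial>lborel) \<partial>lborel) \<le> ennreal M"
  shows "norm (T u - T v) \<le> 2 * C * M powr (1 / q) * (v - u) powr (1 - 2 / q)"
proof -
  define d where "d = v - u"
  define \<alpha> where "\<alpha> = 1 - 2 / q"
  define I where "I = {u..v}"
  have d: "d > 0" using assms by (simp add: d_def)
  define K where "K t s = tp_kernel q \<Gamma> t s" for t s
  have Kmeas[measurable]: "case_prod K \<in> borel_measurable (lborel \<Otimes>\<^sub>M lborel)"
    using measurable_tp_kernel by (simp add: K_def[abs_def])
  have Kmeas'[measurable]: "(\<lambda>(t, s). K s t) \<in> borel_measurable (lborel \<Otimes>\<^sub>M lborel)"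
    using measurable_pair_swap[OF Kmeas] by (simp add: case_prod_beta')
  define J where "J t = (\<integral>\<^sup>+s\<in>I. K t s + K s t \<partial>lborel)" for t
  have [measurable]: "I \<in> sets lborel" "I \<in> sets borel" by (auto simp: I_def)
  have [measurable]: "K t \<in> borel_measurable lborel" "(\<lambda>s. K s t) \<in> borel_measurable lborel" for t
    unfolding K_def by measurable
  have J_eq: "J t = (\<integral>\<^sup>+s\<in>I. K t s \<partial>lborel) + (\<integral>\<^sup>+s\<in>I. K s t \<partial>lborel)" for t
    unfolding J_def distrib_right by (intro nn_integral_add) measurable
  have m1: "(\<lambda>t. \<integral>\<^sup>+s\<in>I. K t s \<partial>lborel) \<in> borel_measurable lborel"
    by (intro lborel.borel_measurable_nn_integral) measurable
  have m2: "(\<lambda>t. \<integral>\<^sup>+s\<in>I. K s t \<partial>lborel) \<in> borel_measurable lborel"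
    by (intro lborel.borel_measurable_nn_integral) measurable
  note [measurable] = m1 m2
  have Jm[measurable]: "J \<in> borel_measurable lborel" unfolding J_eq[abs_def] by measurable
  have "(\<integral>\<^sup>+t\<in>I. J t \<partial>lborel) =
      (\<integral>\<^sup>+t\<in>I. (\<integral>\<^sup>+s\<in>I. K t s \<partial>lborel) \<partial>lborel) + (\<integral>\<^sup>+t\<in>I. (\<integral>\<^sup>+s\<in>I. K s t \<partial>lborel) \<partial>lborel)"
    unfolding J_eq distrib_right by (intro nn_integral_add) measurable
  also have "(\<integral>\<^sup>+t\<in>I. (\<integral>\<^sup>+s\<in>I. K t s \<partial>lborel) \<partial>lborel) = (\<integral>\<^sup>+t\<in>I. (\<integral>\<^sup>+s\<in>I. K s t \<partial>lborel) \<partial>lborel)"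
    using kernel_integral_swap[of I] by (simp add: K_def)
  also have "\<dots> + (\<integral>\<^sup>+t\<in>I. (\<integral>\<^sup>+s\<in>I. K s t \<partial>lborel) \<partial>lborel) \<le> ennreal M + ennreal M"
    using energy by (intro add_mono) (auto simp: K_def I_def)
  also have "\<dots> = ennreal (2 * M)" using \<open>M > 0\<close> by (simp flip: ennreal_plus)
  finally have J: "(\<integral>\<^sup>+t\<in>I. J t \<partial>lborel) \<le> ennreal (2 * M)" .
  have powq: "64 powr (1 / q) \<le> (8::real)"
  proof -
    have "64 powr (1 / q) \<le> (64::real) powr (1 / 2)" using q by (intro powr_mono) (auto simp: field_simps)
    also have "\<dots> = 8" by (simp add: powr_half_sqrt real_sqrt_unique)
    finally show ?thesis .
  qed
  have window: "\<exists>p. w \<in> {p..p + a} \<and> {p..p + a} \<subseteq> I" if "w \<in> I" "0 < a" "a \<le> d" for w a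
    using that by (intro exI[of _ "if w + a \<le> v then w else v - a"]) (auto simp: I_def d_def)
  have step: "\<exists>t1\<in>I. \<bar>t1 - w\<bar> \<le> \<rho> / 2 \<and> J t1 \<le> ennreal (8 * M / (\<rho> / 2)) \<and>
      norm (T t - T t1) \<le> 64 * M powr (1 / q) * \<rho> powr \<alpha>"
    if w: "w \<in> I" and \<rho>: "0 < \<rho>" "\<rho> \<le> d" and t: "t \<in> I" "\<bar>t - w\<bar> \<le> \<rho>" "J t \<le> ennreal (8 * M / \<rho>)" for w t \<rho>
  proof -
    obtain p where p: "w \<in> {p..p + \<rho> / 2}" "{p..p + \<rho> / 2} \<subseteq> I" using window[OF w, of "\<rho> / 2"] \<rho> by auto
    have "\<exists>t1\<in>{p..p + \<rho> / 2}. J t1 \<le> ennreal (4 * (2 * M) / (\<rho> / 2)) \<and> K t t1 + K t1 t \<le> ennreal (4 * (8 * M / \<rho>) / (\<rho> / 2))"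
      using J t(3) p \<rho> \<open>M > 0\<close> by (intro exists_le_of_two_nn_integrals[where X = I]) (auto simp: J_def)
    then obtain t1 where t1: "t1 \<in> {p..p + \<rho> / 2}" "J t1 \<le> ennreal (8 * M / (\<rho> / 2))"
      and H: "K t t1 + K t1 t \<le> ennreal (64 * M / \<rho>\<^sup>2)"
      by (auto simp: power2_eq_square)
    have t1w: "\<bar>t1 - w\<bar> \<le> \<rho> / 2" using t1(1) p(1) unfolding atLeastAtMost_iff abs_le_iff by linarith
    have t1I: "t1 \<in> I" using t1 p by blast
    have "norm (T t - T t1) \<le> 64 * M powr (1 / q) * \<rho> powr \<alpha>"
    proof (cases "t = t1")
      case False
      have ttd: "\<bar>t1 - t\<bar> \<le> d" using t t1I by (auto simp: I_def d_def)
      have "flatness (2 * \<bar>t1 - t\<bar>) \<le> flatness (2 * d)" using ttd by (intro flatness_mono) auto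
      then have "2 * B * flatness (2 * \<bar>t1 - t\<bar>) \<le> 2 * B * flatness (2 * d)" using B_ge by (intro mult_left_mono) auto
      then have "small_scale (2 * \<bar>t1 - t\<bar>)" using small ttd by (auto simp: d_def)
      moreover have "K t t1 \<le> ennreal (64 * M / \<rho>\<^sup>2)" "K t1 t \<le> ennreal (64 * M / \<rho>\<^sup>2)"
        by (rule order_trans[OF _ H], simp)+
      ultimately have "norm (T t - T t1) \<le> 4 * \<bar>t1 - t\<bar> * (64 * M / \<rho>\<^sup>2) powr (1 / q)"
        using False \<open>M > 0\<close> by (intro derivative_increment_le) (auto simp: K_def)
      also have "\<dots> \<le> 4 * (2 * \<rho>) * (64 * M / \<rho>\<^sup>2) powr (1 / q)"
      proof (intro mult_right_mono mult_left_mono)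
        show "\<bar>t1 - t\<bar> \<le> 2 * \<rho>" using t(2) t1w \<rho> by linarith
      qed auto
      also have "(64 * M / \<rho>\<^sup>2) powr (1 / q) = 64 powr (1 / q) * M powr (1 / q) / \<rho> powr (2 / q)"
        using \<open>M > 0\<close> \<rho> by (simp add: powr_divide powr_mult powr_powr flip: powr_numeral)
      also have "4 * (2 * \<rho>) * (64 powr (1 / q) * M powr (1 / q) / \<rho> powr (2 / q)) =
          8 * 64 powr (1 / q) * (M powr (1 / q) * \<rho> powr \<alpha>)"
        using \<rho> by (simp add: \<alpha>_def powr_diff)
      also have "\<dots> \<le> 8 * 8 * (M powr (1 / q) * \<rho> powr \<alpha>)"
        using powq by (intro mult_right_mono mult_left_mono) auto
      finally show ?thesis by simp
    qed (simp)
    then show ?thesis using t1w t1I t1 by blast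
  qed
  have chain: "\<exists>t'\<in>I. \<bar>t' - w\<bar> \<le> \<rho> / 2 ^ m \<and> norm (T t - T t') \<le> C * M powr (1 / q) * \<rho> powr \<alpha>"
    if w: "w \<in> I" and "0 < \<rho>" "\<rho> \<le> d" "t \<in> I" "\<bar>t - w\<bar> \<le> \<rho>" "J t \<le> ennreal (8 * M / \<rho>)" for w t \<rho> m
    using that(2-)
  proof (induction m arbitrary: t \<rho>)
    case 0
    then show ?case using C_pos by (intro bexI[of _ t]) auto
  next
    case (Suc m)
    obtain t1 where t1: "t1 \<in> I" "\<bar>t1 - w\<bar> \<le> \<rho> / 2" "J t1 \<le> ennreal (8 * M / (\<rho> / 2))"
      "norm (T t - T t1) \<le> 64 * M powr (1 / q) * \<rho> powr \<alpha>"
      using step[OF w Suc.prems] by blast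
    obtain t' where t': "t' \<in> I" "\<bar>t' - w\<bar> \<le> \<rho> / 2 / 2 ^ m" "norm (T t1 - T t') \<le> C * M powr (1 / q) * (\<rho> / 2) powr \<alpha>"
    proof -
      have "\<exists>t'\<in>I. \<bar>t' - w\<bar> \<le> \<rho> / 2 / 2 ^ m \<and> norm (T t1 - T t') \<le> C * M powr (1 / q) * (\<rho> / 2) powr \<alpha>"
        using Suc.prems t1 by (intro Suc.IH) auto
      then show ?thesis using that by blast
    qed
    have "norm (T t - T t') \<le> 64 * M powr (1 / q) * \<rho> powr \<alpha> + C * M powr (1 / q) * (\<rho> / 2) powr \<alpha>"
      using t1(4) t'(3) norm_triangle_ineq[of "T t - T t1" "T t1 - T t'"] by simp
    also have "\<dots> = (64 + C * 2 powr (- \<alpha>)) * (M powr (1 / q) * \<rho> powr \<alpha>)"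
    proof -
      have "(\<rho> / 2) powr \<alpha> = 2 powr (- \<alpha>) * \<rho> powr \<alpha>"
        using Suc.prems by (simp add: powr_divide powr_minus_divide)
      then show ?thesis by (simp only: algebra_simps)
    qed
    also have "64 + C * 2 powr (- \<alpha>) = C" using C_eq by (simp add: \<alpha>_def)
    finally show ?case using t' by (intro bexI[of _ t']) (auto simp: mult.assoc)
  qed
  have "\<exists>t0\<in>{u..u + d}. J t0 \<le> ennreal (2 * (2 * M) / d)"
    using exists_le_of_nn_integral[OF d _ _ J, of u "\<lambda>_. True"] \<open>M > 0\<close> by (auto simp: I_def d_def)
  then obtain t0 where t0: "t0 \<in> I" "J t0 \<le> ennreal (4 * M / d)" by (auto simp: I_def d_def)
  have J0: "J t0 \<le> ennreal (8 * M / d)"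
    using t0(2) by (rule order_trans) (use d \<open>M > 0\<close> in \<open>auto intro!: ennreal_leI divide_right_mono\<close>)
  have limit: "norm (T t0 - T w) \<le> C * M powr (1 / q) * d powr \<alpha>" if w: "w \<in> I" for w
  proof (rule field_le_epsilon)
    fix r :: real assume "r > 0"
    then obtain h where h: "h > 0" "\<And>y. dist y w < h \<Longrightarrow> dist (T y) (T w) < r"
      using continuous_derivative unfolding continuous_on_iff by blast
    obtain m where "(1 / 2) ^ m < h / d"
      using real_arch_pow_inv[of "h / d" "1 / 2"] h d by auto
    then have m: "d / 2 ^ m < h" using d by (simp add: field_simps)
    have "\<bar>t0 - w\<bar> \<le> d" using t0 w by (auto simp: I_def d_def)
    then obtain t' where t': "\<bar>t' - w\<bar> \<le> d / 2 ^ m" "norm (T t0 - T t') \<le> C * M powr (1 / q) * d powr \<alpha>"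
      using chain[OF w d order_refl t0(1) _ J0, of m] by blast
    have "norm (T t' - T w) < r" using h(2)[of t'] t' m by (simp add: dist_norm)
    then show "norm (T t0 - T w) \<le> C * M powr (1 / q) * d powr \<alpha> + r"
      using t'(2) norm_triangle_ineq[of "T t0 - T t'" "T t' - T w"] by simp
  qed
  have "norm (T u - T v) \<le> 2 * (C * M powr (1 / q) * d powr \<alpha>)"
    using limit[of u] limit[of v] \<open>u < v\<close> norm_triangle_ineq4[of "T t0 - T v" "T t0 - T u"] by (simp add: I_def)
  then show ?thesis by (simp add: d_def \<alpha>_def mult.assoc)
qed

end

section \<open>The circle and Euclidean space\<close>

lemma round_representative:
  assumes "L > 0"
  shows "\<bar>(u - v) - of_int (round ((u - v) / L)) * L\<bar> \<le> \<bar>(u - v) - of_int k * L\<bar>"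
    and "\<bar>(u - v) - of_int (round ((u - v) / L)) * L\<bar> \<le> L / 2"
proof -
  have eq: "\<bar>(u - v) - of_int k * L\<bar> = L * \<bar>(u - v) / L - of_int k\<bar>" for k
  proof -
    have "(u - v) - of_int k * L = L * ((u - v) / L - of_int k)" using assms by (simp add: field_simps)
    then show ?thesis using assms by (simp only: abs_mult)
  qed
  show "\<bar>(u - v) - of_int (round ((u - v) / L)) * L\<bar> \<le> \<bar>(u - v) - of_int k * L\<bar>"
    unfolding eq using assms round_diff_minimal[of "(u - v) / L" k] by (intro mult_left_mono) auto
  have "\<bar>(u - v) / L - of_int (round ((u - v) / L))\<bar> \<le> 1 / 2"
    using of_int_round_abs_le[of "(u - v) / L"] by (simp add: abs_minus_commute)
  then show "\<bar>(u - v) - of_int (round ((u - v) / L)) * L\<bar> \<le> L / 2"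
    unfolding eq using assms mult_left_mono[of _ "1 / 2" L] by fastforce
qed

lemma circle_dist_eq:
  assumes "L > 0"
  shows "circle_dist L u v = \<bar>u - (v + of_int (round ((u - v) / L)) * L)\<bar>"
proof -
  have "Inf (range (\<lambda>k::int. \<bar>u - v + of_int k * L\<bar>)) = \<bar>(u - v) - of_int (round ((u - v) / L)) * L\<bar>"
  proof (rule cInf_eq_minimum)
    have "\<bar>(u - v) - of_int (round ((u - v) / L)) * L\<bar> = \<bar>u - v + of_int (- round ((u - v) / L)) * L\<bar>" by simp
    then show "\<bar>(u - v) - of_int (round ((u - v) / L)) * L\<bar> \<in> range (\<lambda>k::int. \<bar>u - v + of_int k * L\<bar>)" by blast
    fix x assume "x \<in> range (\<lambda>k::int. \<bar>u - v + of_int k * L\<bar>)"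
    then obtain k :: int where "x = \<bar>u - v + of_int k * L\<bar>" by blast
    then show "\<bar>(u - v) - of_int (round ((u - v) / L)) * L\<bar> \<le> x"
      using round_representative(1)[OF assms, of u v "- k"] by simp
  qed
  then show ?thesis by (simp add: circle_dist_def diff_diff_eq)
qed

lemma circle_dist_le: "L > 0 \<Longrightarrow> circle_dist L u v \<le> \<bar>u - v\<bar>"
  using round_representative(1)[of L u v 0] by (simp add: circle_dist_eq diff_diff_eq)

text \<open>
  Limits are taken in each coordinate; on \<open>Rn n\<close> the norm is at most the sum of the
  absolute values of the first \<open>n\<close> coordinates.
\<close>
lemma complete_Rn: "complete (Rn n)"
  unfolding complete_def
proof (intro allI impI, elim conjE)
  fix f :: "nat \<Rightarrow> rinf" assume f: "\<forall>k. f k \<in> Rn n" and "Cauchy f"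
  have "Cauchy (\<lambda>k. coord (f k) i)" if "i < n" for i
  proof (rule CauchyI)
    fix e :: real assume "e > 0"
    then obtain N where N: "\<And>k m. k \<ge> N \<Longrightarrow> m \<ge> N \<Longrightarrow> norm (f k - f m) < e"
      using CauchyD[OF \<open>Cauchy f\<close>] by blast
    have "norm (coord (f k) i - coord (f m) i) \<le> norm (f k - f m)" for k m
    proof -
      have "f k - f m \<in> Rn n" using f by (auto simp: Rn_def)
      then have "norm (f k - f m) = L2_set (\<lambda>i. \<bar>coord (f k - f m) i\<bar>) {..<n}"
        by (simp add: norm_Rn L2_set_def)
      then show ?thesis
        using member_le_L2_set[of "{..<n}" i "\<lambda>i. \<bar>coord (f k - f m) i\<bar>"] that by simp
    qed
    then show "\<exists>M. \<forall>m\<ge>M. \<forall>k\<ge>M. norm (coord (f m) i - coord (f k) i) < e"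
      using N by (meson order_le_less_trans)
  qed
  then have "\<exists>l. (\<lambda>k. coord (f k) i) \<longlonglongrightarrow> l" if "i < n" for i
    using that by (simp add: Cauchy_convergent_iff convergent_def)
  then obtain l where l: "\<And>i. i < n \<Longrightarrow> (\<lambda>k. coord (f k) i) \<longlonglongrightarrow> l i" by metis
  define y where "y = Abs_rinf (\<lambda>i. if i < n then l i else 0)"
  have "finite {i. (if i < n then l i else 0) \<noteq> 0}"
    by (rule finite_subset[of _ "{..<n}"]) auto
  then have y: "coord y i = (if i < n then l i else 0)" for i
    by (simp add: y_def Abs_rinf_inverse)
  then have "y \<in> Rn n" by (simp add: Rn_def)
  have "(\<lambda>k. \<Sum>i<n. \<bar>coord (f k) i - l i\<bar>) \<longlonglongrightarrow> (\<Sum>i<n. \<bar>l i - l i\<bar>)"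
    by (intro tendsto_intros l) auto
  then have lim: "(\<lambda>k. \<Sum>i<n. \<bar>coord (f k) i - l i\<bar>) \<longlonglongrightarrow> 0" by simp
  have "norm (f k - y) \<le> (\<Sum>i<n. \<bar>coord (f k) i - l i\<bar>)" for k
  proof -
    have "f k - y \<in> Rn n" using f \<open>y \<in> Rn n\<close> by (auto simp: Rn_def)
    then show ?thesis
      using L2_set_le_sum_abs[of "coord (f k - y)" "{..<n}"] by (simp add: norm_Rn y)
  qed
  then have "(\<lambda>k. f k - y) \<longlonglongrightarrow> 0"
    by (intro Lim_null_comparison[OF _ lim] always_eventually) auto
  then have "f \<longlonglongrightarrow> y" by (simp add: LIM_zero_iff)
  then show "\<exists>l\<in>Rn n. f \<longlonglongrightarrow> l" using \<open>y \<in> Rn n\<close> by blast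
qed

lemma finite_energy_curveI:
  assumes \<Gamma>: "injective_arclength_parametrization n L \<Gamma>" and "q > 2" "E > 0"
    and "tangent_point_energy q L \<Gamma> \<le> ennreal E"
  shows "finite_energy_curve \<Gamma> L q E (Rn n)"
proof
  from \<Gamma> obtain C where L: "L > 0" and Rn: "range \<Gamma> \<subseteq> Rn n" and C: "\<And>u v. dist (\<Gamma> u) (\<Gamma> v) \<le> C * circle_dist L u v"
    unfolding injective_arclength_parametrization_def arclength_parametrization_def by auto
  show "\<exists>C. \<forall>u v. dist (\<Gamma> u) (\<Gamma> v) \<le> C * \<bar>u - v\<bar>"
  proof (intro exI allI)
    fix u v
    have "dist (\<Gamma> u) (\<Gamma> v) \<le> \<bar>C\<bar> * circle_dist L u v"
      by (rule order_trans[OF C]) (auto simp: circle_dist_eq[OF L] intro!: mult_right_mono)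
    also have "\<dots> \<le> \<bar>C\<bar> * \<bar>u - v\<bar>" using circle_dist_le[OF L] by (intro mult_left_mono) auto
    finally show "dist (\<Gamma> u) (\<Gamma> v) \<le> \<bar>C\<bar> * \<bar>u - v\<bar>" .
  qed
  show "c *\<^sub>R (\<Gamma> u - \<Gamma> v) \<in> Rn n" for c u v
    using Rn subspace_Rn[of n] by (intro subspace_scale subspace_diff) auto
qed (use assms complete_Rn in \<open>auto simp: injective_arclength_parametrization_def arclength_parametrization_def\<close>)

text \<open>
  An arc of length at most \<open>L\<close> that starts in \<open>{0..<L}\<close> and goes in either direction lies in
  \<open>{-L..2*L}\<close>, which consists of three periods.
\<close>
lemma nn_integral_periodic_le:
  fixes f :: "real \<Rightarrow> ennreal"
  assumes [measurable]: "f \<in> borel_measurable borel" and "L > 0" and per: "\<And>t. f (t + L) = f t"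
  shows "(\<integral>\<^sup>+t\<in>{-L..2*L}. f t \<partial>lborel) \<le> 3 * (\<integral>\<^sup>+t\<in>{0..L}. f t \<partial>lborel)"
proof -
  have per': "f (t - L) = f t" for t using per[of "t - L"] by simp
  have "(\<integral>\<^sup>+t\<in>{-L..2*L}. f t \<partial>lborel) \<le> (\<integral>\<^sup>+t. f t * indicator {0..L} t + (f (L + 1 * t) * indicator {0..L} (L + 1 * t) +
      f (- L + 1 * t) * indicator {0..L} (- L + 1 * t)) \<partial>lborel)"
    using per per' by (intro nn_integral_mono) (auto simp: indicator_def add.commute)
  also have "\<dots> = (\<integral>\<^sup>+t\<in>{0..L}. f t \<partial>lborel) + ((\<integral>\<^sup>+t. f (L + 1 * t) * indicator {0..L} (L + 1 * t) \<partial>lborel) +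
      (\<integral>\<^sup>+t. f (- L + 1 * t) * indicator {0..L} (- L + 1 * t) \<partial>lborel))"
    by (simp add: nn_integral_add)
  also have "(\<integral>\<^sup>+t. f (L + 1 * t) * indicator {0..L} (L + 1 * t) \<partial>lborel) = (\<integral>\<^sup>+t\<in>{0..L}. f t \<partial>lborel)"
    using nn_integral_real_affine[of "\<lambda>t. f t * indicator {0..L} t" 1 L] by simp
  also have "(\<integral>\<^sup>+t. f (- L + 1 * t) * indicator {0..L} (- L + 1 * t) \<partial>lborel) = (\<integral>\<^sup>+t\<in>{0..L}. f t \<partial>lborel)"
    using nn_integral_real_affine[of "\<lambda>t. f t * indicator {0..L} t" 1 "- L"] by simp
  also have "x + (x + x) = 3 * x" for x :: ennreal
  proof -
    have "(3::ennreal) = 1 + (1 + 1)" by simp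
    then show ?thesis by (simp only: distrib_right mult_1)
  qed
  finally show ?thesis .
qed

context finite_energy_curve begin

section \<open>Regularity on the circle\<close>

lemma derivative_periodic: "T (t + of_int k * L) = T t"
proof -
  have "((\<Gamma> \<circ> (\<lambda>x. x + of_int k * L)) has_vector_derivative (1 *\<^sub>R T (t + of_int k * L))) (at t)"
    using differentiable_everywhere(1)[of "t + of_int k * L"]
    by (intro vector_diff_chain_at) (auto intro!: derivative_eq_intros)
  then have "(\<Gamma> has_vector_derivative T (t + of_int k * L)) (at t)"
    by (simp add: comp_def periodic_int)
  then show ?thesis by (metis vector_derivative_at)
qed

lemma tp_kernel_periodic: "tp_kernel q \<Gamma> (t + L) s = tp_kernel q \<Gamma> t s" "tp_kernel q \<Gamma> t (s + L) = tp_kernel q \<Gamma> t s"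
  using derivative_periodic[of t 1] periodic_int[of t 1] periodic_int[of s 1]
  by (simp_all add: tp_kernel_def tangent_point_radius_def tangent_line_def)

lemma local_energy_le:
  assumes "X \<subseteq> {-L..2*L}"
  shows "(\<integral>\<^sup>+t\<in>X. (\<integral>\<^sup>+s\<in>X. tp_kernel q \<Gamma> s t \<partial>lborel) \<partial>lborel) \<le> ennreal (9 * E)"
proof -
  note [measurable] = measurable_tp_kernel
  define Y where "Y = {-L..2*L}"
  have [measurable]: "Y \<in> sets lborel" "Y \<in> sets borel" by (auto simp: Y_def)
  define K where "K t s = tp_kernel q \<Gamma> t s" for t s
  have [measurable]: "case_prod K \<in> borel_measurable (lborel \<Otimes>\<^sub>M lborel)"
    using measurable_tp_kernel by (simp add: K_def[abs_def])
  define J where "J t = (\<integral>\<^sup>+s\<in>{0..L}. K t s \<partial>lborel)" for t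
  have Jm: "J \<in> borel_measurable borel"
  proof -
    have "J \<in> borel_measurable lborel" unfolding J_def[abs_def]
      by (intro lborel.borel_measurable_nn_integral) measurable
    then show ?thesis by simp
  qed
  have "(\<integral>\<^sup>+t\<in>X. (\<integral>\<^sup>+s\<in>X. K s t \<partial>lborel) \<partial>lborel) \<le> (\<integral>\<^sup>+t\<in>Y. (\<integral>\<^sup>+s\<in>Y. K s t \<partial>lborel) \<partial>lborel)"
    using assms by (intro nn_integral_mono mult_mono) (auto simp: indicator_def Y_def)
  also have "\<dots> = (\<integral>\<^sup>+t\<in>Y. (\<integral>\<^sup>+s\<in>Y. K t s \<partial>lborel) \<partial>lborel)"
    unfolding K_def by (rule kernel_integral_swap[symmetric]) measurable
  also have "\<dots> \<le> (\<integral>\<^sup>+t\<in>Y. 3 * J t \<partial>lborel)"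
    unfolding Y_def J_def K_def using L tp_kernel_periodic measurable_tp_kernel2
    by (intro nn_integral_mono mult_right_mono nn_integral_periodic_le) auto
  also have "\<dots> = 3 * (\<integral>\<^sup>+t\<in>Y. J t \<partial>lborel)"
    using Jm by (subst nn_integral_cmult[symmetric]) (auto simp: mult.assoc)
  also have "\<dots> \<le> 3 * (3 * (\<integral>\<^sup>+t\<in>{0..L}. J t \<partial>lborel))"
    unfolding Y_def using L Jm
    by (intro mult_left_mono nn_integral_periodic_le) (auto simp: J_def K_def tp_kernel_periodic)
  also have "\<dots> \<le> 3 * (3 * ennreal E)"
    using energy by (intro mult_left_mono) (auto simp: J_def K_def tp_kernel_def tangent_point_energy_def)
  also have "\<dots> = ennreal (9 * E)"
    using E by (simp add: ennreal_mult mult.assoc[symmetric])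
  finally show ?thesis by (simp add: K_def)
qed

text \<open>
  The case \<open>M = 0\<close> follows by letting positive bounds tend to zero.
\<close>
lemma derivative_holder_arc:
  assumes small: "small_scale (2 * \<bar>u - v\<bar>)" and "M \<ge> 0"
    and energy: "(\<integral>\<^sup>+t\<in>closed_segment u v. (\<integral>\<^sup>+s\<in>closed_segment u v. tp_kernel q \<Gamma> s t \<partial>lborel) \<partial>lborel) \<le> ennreal M"
  shows "norm (T u - T v) \<le> 2 * C * M powr (1 / q) * \<bar>u - v\<bar> powr (1 - 2 / q)"
proof -
  have pos: "norm (T u - T v) \<le> 2 * C * M' powr (1 / q) * \<bar>u - v\<bar> powr (1 - 2 / q)" if M': "M' > 0" "M \<le> M'" for M'
  proof -
    have en: "(\<integral>\<^sup>+t\<in>closed_segment u v. (\<integral>\<^sup>+s\<in>closed_segment u v. tp_kernel q \<Gamma> s t \<partial>lborel) \<partial>lborel) \<le> ennreal M'"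
      using energy by (rule order_trans) (use M' in \<open>simp add: ennreal_leI\<close>)
    consider "u < v" | "v < u" | "u = v" by linarith
    then show ?thesis
    proof cases
      case 1
      then show ?thesis using derivative_holder_positive[of u v M'] small M' en
        by (simp add: closed_segment_eq_real_ivl abs_minus_commute)
    next
      case 2
      then show ?thesis using derivative_holder_positive[of v u M'] small M' en
        by (simp add: closed_segment_eq_real_ivl norm_minus_commute)
    qed (use C_pos in simp)
  qed
  show ?thesis
  proof (cases "M = 0")
    case False
    then show ?thesis using pos[of M] \<open>M \<ge> 0\<close> by simp
  next
    case True
    have "norm (T u - T v) \<le> 0 + r" if "r > 0" for r
    proof -
      define k where "k = 2 * C * \<bar>u - v\<bar> powr (1 - 2 / q)"
      have k: "k \<ge> 0" using C_pos by (simp add: k_def)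
      \<comment> \<open>this makes \<open>k * M' powr (1 / q)\<close> at most \<open>r\<close>\<close>
      define M' where "M' = (r / (k + 1)) powr q"
      have "M' > 0" using k \<open>r > 0\<close> by (simp add: M'_def)
      have "norm (T u - T v) \<le> k * M' powr (1 / q)"
        using pos[of M'] \<open>M' > 0\<close> True by (simp add: k_def mult_ac)
      also have "M' powr (1 / q) = r / (k + 1)" using q k \<open>r > 0\<close> by (simp add: M'_def powr_powr)
      also have "k * (r / (k + 1)) \<le> r" using k \<open>r > 0\<close> by (simp add: field_simps)
      finally show ?thesis by simp
    qed
    then show ?thesis using True field_le_epsilon[of "norm (T u - T v)" 0] by simp
  qed
qed

text \<open>
  Nearby parameters are covered by the estimate on arcs, since the energy of an arc is at most \<open>9 * E\<close>.  For the
  others the Hoelder quotient is bounded because the tangents are unit vectors.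
\<close>
lemma C1_holder: "C1_holder_on_circle L (1 - 2 / q) \<Gamma>"
  unfolding C1_holder_on_circle_def
proof
  show "\<Gamma> C1_differentiable_on UNIV"
    unfolding C1_differentiable_on_def
    using differentiable_everywhere(1) continuous_derivative by (intro exI[of _ "\<lambda>t. T t"]) auto
  define \<alpha> where "\<alpha> = 1 - 2 / q"
  have \<alpha>: "\<alpha> > 0" using q by (simp add: \<alpha>_def)
  define r where "r = min L (1 / 64)"
  have "r > 0" using L by (simp add: r_def)
  obtain h0 where h0: "h0 > 0" "\<And>h. 0 < h \<Longrightarrow> h \<le> h0 \<Longrightarrow> 2 * h \<le> r \<and> B * flatness h \<le> r"
    using eventually_small[OF \<open>r > 0\<close>] by blast
  define A1 where "A1 = 2 * C * (9 * E) powr (1 / q)"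
  define A2 where "A2 = 2 / (h0 / 2) powr \<alpha>"
  have A: "A1 \<ge> 0" "A2 \<ge> 0" using C_pos by (auto simp: A1_def A2_def)
  have "norm (T u - T v) \<le> (A1 + A2) * circle_dist L u v powr \<alpha>" for u v
  proof -
    define v' where "v' = v + of_int (round ((u - v) / L)) * L"
    obtain u0 k where u0: "u0 \<in> {0..<L}" "u0 = u + of_int k * L" using period_representative[of u] by blast
    define v0 where "v0 = v' + of_int k * L"
    define d where "d = \<bar>u0 - v0\<bar>"
    have d: "circle_dist L u v = d" "d \<ge> 0" "d \<le> L"
      using round_representative(2)[OF L, of u v] L
      by (auto simp: circle_dist_eq[OF L] d_def u0 v0_def v'_def diff_diff_eq)
    have Tuv: "T u0 = T u" "T v0 = T v" by (simp_all add: u0 v0_def v'_def derivative_periodic)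
    show ?thesis
    proof (cases "d \<le> h0 / 2")
      case True
      have small: "small_scale (2 * \<bar>u0 - v0\<bar>)"
      proof (cases "u0 = v0")
        case False
        then show ?thesis using h0(2)[of "2 * d"] True by (simp add: d_def r_def)
      qed (use L in \<open>simp add: flatness_def\<close>)
      have "closed_segment u0 v0 \<subseteq> {-L..2*L}"
        using u0(1) d(3) by (auto simp: closed_segment_eq_real_ivl d_def split: if_splits)
      then have "norm (T u0 - T v0) \<le> A1 * d powr \<alpha>"
        using derivative_holder_arc[OF small, of "9 * E"] local_energy_le E
        by (simp add: A1_def \<alpha>_def d_def)
      also have "\<dots> \<le> (A1 + A2) * d powr \<alpha>" using A by (intro mult_right_mono) auto
      finally show ?thesis by (simp add: Tuv d)
    next
      case False
      have "norm (T u - T v) \<le> norm (T u) + norm (T v)" by (rule norm_triangle_ineq4)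
      also have "\<dots> = A2 * (h0 / 2) powr \<alpha>" using h0(1) by (simp add: norm_derivative A2_def)
      also have "\<dots> \<le> (A1 + A2) * d powr \<alpha>"
        using A False h0(1) \<alpha> by (intro mult_mono powr_mono2) auto
      finally show ?thesis by (simp add: d)
    qed
  qed
  then show "\<exists>C. \<forall>u v. norm (T u - T v) \<le> C * circle_dist L u v powr (1 - 2 / q)"
    unfolding \<alpha>_def by blast
qed

lemma diameter_le_half_length: "diameter (range \<Gamma>) \<le> L / 2"
proof (rule diameter_le)
  fix x y assume "x \<in> range \<Gamma>" "y \<in> range \<Gamma>"
  then obtain u v where uv: "x = \<Gamma> u" "y = \<Gamma> v" by blast
  have "norm (\<Gamma> u - \<Gamma> (v + of_int (round ((u - v) / L)) * L)) \<le> L / 2"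
    by (rule order_trans[OF nonexpansive]) (use round_representative(2)[OF L, of u v] in \<open>simp add: diff_diff_eq\<close>)
  then show "norm (x - y) \<le> L / 2" by (simp add: uv periodic_int)
qed (use L in simp)

lemma small_scaleI:
  assumes "0 \<le> d" "d \<le> range_const q * E powr (- (1 / (q - 2)))" "d \<le> L / 4"
  shows "small_scale (2 * d)"
proof -
  have B: "B > 0" using B_ge by simp
  define b where "b = 1 / (64 * B)"
  have b: "b > 0" using B by (simp add: b_def)
  have "2 * d \<le> b powr ((q + 2) / (q - 2)) * E powr (- (1 / (q - 2)))"
    using assms(2) by (simp add: range_const_def b_def)
  then have "(2 * d) powr (q - 2) \<le> (b powr ((q + 2) / (q - 2)) * E powr (- (1 / (q - 2)))) powr (q - 2)"
    using q assms(1) by (intro powr_mono2) auto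
  also have "\<dots> = b powr ((q + 2) / (q - 2) * (q - 2)) * E powr (- (1 / (q - 2)) * (q - 2))"
    by (simp only: powr_mult powr_powr)
  also have "\<dots> = b powr (q + 2) * E powr (- 1)" using q by simp
  also have "\<dots> = b powr (q + 2) / E" using E by (simp add: powr_minus_divide)
  finally have "E * (2 * d) powr (q - 2) \<le> b powr (q + 2)" using E by (simp add: field_simps)
  then have "flatness (2 * d) \<le> (b powr (q + 2)) powr (1 / (q + 2))"
    unfolding flatness_def using q E by (intro powr_mono2) auto
  also have "\<dots> = b" using b q by (simp add: powr_powr)
  finally have "2 * B * flatness (2 * d) \<le> 2 * B * b" using B by (intro mult_left_mono) auto
  also have "\<dots> = 1 / 32" using B by (simp add: b_def)
  finally show ?thesis using assms(3) by simp
qed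

end

lemma finite_energy_curve_enn2real:
  assumes "injective_arclength_parametrization n L \<Gamma>" and fin: "tangent_point_energy q L \<Gamma> < top" and "q > 2"
  shows "finite_energy_curve \<Gamma> L q (enn2real (tangent_point_energy q L \<Gamma>) + 1) (Rn n)"
proof -
  have "tangent_point_energy q L \<Gamma> = ennreal (enn2real (tangent_point_energy q L \<Gamma>))"
    using fin by (simp add: less_top)
  also have "\<dots> \<le> ennreal (enn2real (tangent_point_energy q L \<Gamma>) + 1)" by (intro ennreal_leI) simp
  finally show ?thesis
    using assms by (intro finite_energy_curveI) (auto simp: add_nonneg_pos)
qed

text \<open>
  A closed curve of length \<open>L\<close> has diameter at most \<open>L / 2\<close>, so half the diameter is at most \<open>L / 4\<close>;
  together with the bound by the energy this yields the smallness condition of the estimate on arcs.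
\<close>
lemma derivative_local_energy_estimate:
  assumes \<Gamma>: "injective_arclength_parametrization n L \<Gamma>" and fin: "tangent_point_energy q L \<Gamma> < top"
    and "q > 2"
    and small: "ennreal (circle_dist L u v) \<le>
            min (ennreal (range_const q) * inverse (ennreal_powr (tangent_point_energy q L \<Gamma>) (1 / (q - 2))))
                (ennreal (diameter (range \<Gamma>) / 2))"
  shows "ennreal (norm (vector_derivative \<Gamma> (at u) - vector_derivative \<Gamma> (at v))) \<le>
            ennreal (2 * holder_const q) *
            ennreal_powr (\<integral>\<^sup>+t\<in>shorter_arc L u v. (\<integral>\<^sup>+s\<in>shorter_arc L u v.
              inverse (ennreal_powr (tangent_point_radius \<Gamma> s t) q) \<partial>lborel) \<partial>lborel) (1 / q) *
            ennreal (circle_dist L u v powr (1 - 2 / q))"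
proof -
  interpret curve: finite_energy_curve \<Gamma> L q "enn2real (tangent_point_energy q L \<Gamma>) + 1" "Rn n"
    using \<Gamma> fin \<open>q > 2\<close> by (rule finite_energy_curve_enn2real)
  define d where "d = circle_dist L u v"
  define v' where "v' = v + of_int (round ((u - v) / L)) * L"
  have d: "d = \<bar>u - v'\<bar>" "d \<ge> 0" using curve.L by (auto simp: d_def v'_def circle_dist_eq)
  have Tv: "vector_derivative \<Gamma> (at v) = vector_derivative \<Gamma> (at v')" by (simp add: v'_def curve.derivative_periodic)
  from small have bound: "ennreal d \<le> ennreal (range_const q) * inverse (ennreal_powr (tangent_point_energy q L \<Gamma>) (1 / (q - 2)))"
    and diam: "ennreal d \<le> ennreal (diameter (range \<Gamma>) / 2)" by (auto simp: d_def)
  have d4: "d \<le> L / 4"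
    using order_trans[OF diam ennreal_leI[of _ "L / 4"]] curve.diameter_le_half_length curve.L by simp
  define \<Lambda> where "\<Lambda> = (\<integral>\<^sup>+t\<in>shorter_arc L u v. (\<integral>\<^sup>+s\<in>shorter_arc L u v.
              inverse (ennreal_powr (tangent_point_radius \<Gamma> s t) q) \<partial>lborel) \<partial>lborel)"
  have \<Lambda>: "\<Lambda> = (\<integral>\<^sup>+t\<in>closed_segment u v'. (\<integral>\<^sup>+s\<in>closed_segment u v'. tp_kernel q \<Gamma> s t \<partial>lborel) \<partial>lborel)"
    by (simp add: \<Lambda>_def shorter_arc_def v'_def tp_kernel_def)
  have "ennreal (norm (vector_derivative \<Gamma> (at u) - vector_derivative \<Gamma> (at v))) \<le>
      ennreal (2 * holder_const q) * ennreal_powr \<Lambda> (1 / q) * ennreal (d powr (1 - 2 / q))"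
  proof (cases "d = 0")
    case True
    then show ?thesis using Tv d by simp
  next
    case False
    then have "d > 0" using d by simp
    define e where "e = enn2real (tangent_point_energy q L \<Gamma>)"
    have e: "tangent_point_energy q L \<Gamma> = ennreal e" "e \<ge> 0" using fin by (auto simp: e_def less_top)
    have rc: "range_const q > 0" using curve.B_ge by (simp add: range_const_def)
    have "\<exists>E>0. tangent_point_energy q L \<Gamma> \<le> ennreal E \<and> d \<le> range_const q * E powr (- (1 / (q - 2)))"
    proof (cases "e = 0")
      case True
      \<comment> \<open>any positive number bounds the energy; with this one the required inequality is an equality\<close>
      define E where "E = (d / range_const q) powr (- (q - 2))"
      have "- (q - 2) * - (1 / (q - 2)) = 1" using \<open>q > 2\<close> by (simp del: minus_diff_eq)
      then have "E powr (- (1 / (q - 2))) = d / range_const q"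
        using \<open>d > 0\<close> rc by (simp only: E_def powr_powr) simp
      then show ?thesis using True e rc \<open>d > 0\<close> by (intro exI[of _ E]) (auto simp: E_def)
    next
      case False
      then have "ennreal d \<le> ennreal (range_const q * inverse (e powr (1 / (q - 2))))"
        using bound e rc by (simp add: ennreal_powr_def inverse_ennreal ennreal_mult)
      then show ?thesis using False e rc
        by (intro exI[of _ e]) (auto simp: powr_minus intro: order_less_imp_le)
    qed
    then obtain E where E: "E > 0" "tangent_point_energy q L \<Gamma> \<le> ennreal E"
      "d \<le> range_const q * E powr (- (1 / (q - 2)))" by blast
    interpret curve': finite_energy_curve \<Gamma> L q E "Rn n"
      using \<Gamma> \<open>q > 2\<close> E by (intro finite_energy_curveI)
    have small': "curve'.small_scale (2 * \<bar>u - v'\<bar>)"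
      using curve'.small_scaleI[OF d(2) E(3) d4] by (simp add: d)
    show ?thesis
    proof (cases "\<Lambda> = top")
      case True
      then show ?thesis using \<open>d > 0\<close> curve.C_pos by (simp add: ennreal_powr_def ennreal_mult_eq_top_iff ennreal_top_mult ennreal_mult_top)
    next
      case False
      then have "\<Lambda> = ennreal (enn2real \<Lambda>)" by (simp add: less_top)
      then have "norm (curve'.T u - curve'.T v') \<le> 2 * holder_const q * enn2real \<Lambda> powr (1 / q) * \<bar>u - v'\<bar> powr (1 - 2 / q)"
        unfolding \<Lambda> by (intro curve'.derivative_holder_arc small') auto
      then show ?thesis using False curve.C_pos
        by (simp add: Tv d ennreal_powr_def ennreal_mult[symmetric] ennreal_leI)
    qed
  qed
  then show ?thesis by (simp add: \<Lambda>_def d_def)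
qed

theorem theorem1p3:
  fixes q :: real
  assumes "q > 2"
  shows "(\<forall>n L \<Gamma>. injective_arclength_parametrization n L \<Gamma> \<and> tangent_point_energy q L \<Gamma> < top
            \<longrightarrow> C1_holder_on_circle L (1 - 2 / q) \<Gamma>) \<and>
    (\<exists>\<delta> c :: real. \<delta> > 0 \<and> c \<ge> 0 \<and>
      (\<forall>n L \<Gamma>. injective_arclength_parametrization n L \<Gamma> \<and> tangent_point_energy q L \<Gamma> < top \<longrightarrow>
        (\<forall>u v.
          ennreal (circle_dist L u v) \<le>
            min (ennreal \<delta> * inverse (ennreal_powr (tangent_point_energy q L \<Gamma>) (1 / (q - 2))))
                (ennreal (diameter (range \<Gamma>) / 2)) \<longrightarrow>
          ennreal (norm (vector_derivative \<Gamma> (at u) - vector_derivative \<Gamma> (at v))) \<le>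
            ennreal c *
            ennreal_powr (\<integral>\<^sup>+t\<in>shorter_arc L u v. (\<integral>\<^sup>+s\<in>shorter_arc L u v.
              inverse (ennreal_powr (tangent_point_radius \<Gamma> s t) q) \<partial>lborel) \<partial>lborel) (1 / q) *
            ennreal (circle_dist L u v powr (1 - 2 / q)))))"
proof (intro conjI allI impI)
  fix n L \<Gamma> assume "injective_arclength_parametrization n L \<Gamma> \<and> tangent_point_energy q L \<Gamma> < top"
  then interpret finite_energy_curve \<Gamma> L q "enn2real (tangent_point_energy q L \<Gamma>) + 1" "Rn n"
    using assms by (intro finite_energy_curve_enn2real) auto
  show "C1_holder_on_circle L (1 - 2 / q) \<Gamma>" by (rule C1_holder)
next
  show "\<exists>\<delta> c :: real. \<delta> > 0 \<and> c \<ge> 0 \<and>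
      (\<forall>n L \<Gamma>. injective_arclength_parametrization n L \<Gamma> \<and> tangent_point_energy q L \<Gamma> < top \<longrightarrow>
        (\<forall>u v.
          ennreal (circle_dist L u v) \<le>
            min (ennreal \<delta> * inverse (ennreal_powr (tangent_point_energy q L \<Gamma>) (1 / (q - 2))))
                (ennreal (diameter (range \<Gamma>) / 2)) \<longrightarrow>
          ennreal (norm (vector_derivative \<Gamma> (at u) - vector_derivative \<Gamma> (at v))) \<le>
            ennreal c *
            ennreal_powr (\<integral>\<^sup>+t\<in>shorter_arc L u v. (\<integral>\<^sup>+s\<in>shorter_arc L u v.
              inverse (ennreal_powr (tangent_point_radius \<Gamma> s t) q) \<partial>lborel) \<partial>lborel) (1 / q) *
            ennreal (circle_dist L u v powr (1 - 2 / q))))"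
    using range_const_pos[OF assms] holder_const_pos[OF assms] derivative_local_energy_estimate[OF _ _ assms]
    by (rule_tac exI[of _ "range_const q"], rule_tac exI[of _ "2 * holder_const q"]) auto
qed

end
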